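(* The $G$-orbit $G\cdot(v_0\otimes\varepsilon_0)\subset V\otimes V^*$ is the homogeneous space $G/Z_{H_\mu}$; that is, the isotropy subgroup of $G$ at $v_0\otimes\varepsilon_0$ is $Z_{H_\mu}$.
   Context: $\mathfrak{g}$ is a complex semisimple Lie algebra, $\mathfrak{h}$ a Cartan subalgebra, $\langle\cdot,\cdot\rangle$ the Cartan–Killing form, $\mathfrak{h}_{\mathbb{R}}$ the real span of the $H_\alpha$ with $\alpha(\cdot)=\langle H_\alpha,\cdot\rangle$, $\alpha$ a root. Fix a Weyl chamber $\mathfrak{h}_{\mathbb{R}}^+$ with simple roots $\Sigma=\{\alpha_1,\dots,\alpha_l\}$ and fundamental weights $\mu_1,\dots,\mu_l$, $\langle\alpha_i^\vee,\mu_j\rangle=\delta_{ij}$. Let $\Theta_0\subset\Sigma$ and let $\mu=\mu_{i_1}+\cdots+\mu_{i_s}$, where $\Sigma\setminus\Theta_0=\{\alpha_{i_1},\dots,\alpha_{i_s}\}$; so for $\alpha\in\Sigma$, $\langle\alpha^\vee,\mu\rangle=0$ iff $\alpha\in\Theta_0$. Let $H_\mu\in\mathfrak{h}_{\mathbb{R}}$ be given by $\mu(\cdot)=\langle H_\mu,\cdot\rangle$. Let $\rho_\mu$ be the irreducible representation of $\mathfrak{g}$ with highest weight $\mu$ on $V=V(\mu)$ (taken faithful, so $\mathfrak{g}\approx\rho_\mu(\mathfrak{g})$), and let $G$ be the connected linear group with Lie algebra $\rho_\mu(\mathfrak{g})\approx\mathfrak{g}$; write $\rho_\mu(g)$ for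 its action on $V$ and $\rho_\mu^*(g)\varepsilon=\varepsilon\circ\rho_\mu(g^{-1})$ for the dual action on $V^*$. $G$ acts on $V\otimes V^*$ by $g\cdot(v\otimes\varepsilon)=\rho_\mu(g)v\otimes\rho_\mu^*(g)\varepsilon$. Let $\{v_0,\dots,v_N\}$ be a basis of $V$ adapted to the weight space decomposition with $v_0$ a highest weight vector, and $\{\varepsilon_0,\dots,\varepsilon_N\}$ the dual basis (so $\varepsilon_0$ spans the lowest weight space of $V^*$). $Z_{H_\mu}=\{g\in G:\mathrm{Ad}(g)H_\mu=H_\mu\}$. *)

theory Defs
  imports "HOL-Analysis.Analysis" "HOL-Algebra.Left_Coset" "HOL-Algebra.Group_Action"
begin

section \<open>Complex semisimple Lie algebras\<close>

class complex_lie_algebra = ab_group_add +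
  fixes scaleC :: "complex \<Rightarrow> 'a \<Rightarrow> 'a" (infixr \<open>*\<^sub>C\<close> 75)
    and lie_bracket :: "'a \<Rightarrow> 'a \<Rightarrow> 'a"
  assumes scaleC_add_right: "a *\<^sub>C (x + y) = a *\<^sub>C x + a *\<^sub>C y"
    and scaleC_add_left: "(a + b) *\<^sub>C x = a *\<^sub>C x + b *\<^sub>C x"
    and scaleC_scaleC: "a *\<^sub>C b *\<^sub>C x = (a * b) *\<^sub>C x"
    and scaleC_one: "1 *\<^sub>C x = x"
    and finite_dimensional: "\<exists>B. finite B \<and> (\<forall>x. \<exists>c. x = (\<Sum>b\<in>B. c b *\<^sub>C b))"
    and lie_bracket_add_left: "lie_bracket (x + y) z = lie_bracket x z + lie_bracket y z"
    and lie_bracket_add_right: "lie_bracket x (y + z) = lie_bracket x y + lie_bracket x z"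
    and lie_bracket_scaleC_left: "lie_bracket (a *\<^sub>C x) y = a *\<^sub>C lie_bracket x y"
    and lie_bracket_scaleC_right: "lie_bracket x (a *\<^sub>C y) = a *\<^sub>C lie_bracket x y"
    and lie_bracket_self: "lie_bracket x x = 0"
    and lie_jacobi: "lie_bracket x (lie_bracket y z) + lie_bracket y (lie_bracket z x)
          + lie_bracket z (lie_bracket x y) = 0"

global_interpretation lie: vector_space "scaleC :: complex \<Rightarrow> 'g::complex_lie_algebra \<Rightarrow> 'g"
  by unfold_locales
    (simp_all add: scaleC_add_right scaleC_add_left scaleC_scaleC scaleC_one)

definition lie_ideal :: "'g::complex_lie_algebra set \<Rightarrow> bool" where
  "lie_ideal I \<longleftrightarrow> lie.subspace I \<and> (\<forall>x. \<forall>y\<in>I. lie_bracket x y \<in> I)"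

primrec derived_series :: "'g::complex_lie_algebra set \<Rightarrow> nat \<Rightarrow> 'g set" where
  "derived_series I 0 = I"
| "derived_series I (Suc k) =
     lie.span {lie_bracket x y | x y. x \<in> derived_series I k \<and> y \<in> derived_series I k}"

definition lie_solvable :: "'g::complex_lie_algebra set \<Rightarrow> bool" where
  "lie_solvable I \<longleftrightarrow> (\<exists>k. derived_series I k = {0})"

text \<open>Semisimplicity in the sense of vanishing radical.\<close>
definition semisimple :: "'g::complex_lie_algebra itself \<Rightarrow> bool" where
  "semisimple _ \<longleftrightarrow> (\<forall>I :: 'g set. lie_ideal I \<longrightarrow> lie_solvable I \<longrightarrow> I = {0})"

text \<open>The trace of a linear endomorphism, computed in an arbitrarily chosen basis
  (\<^term>\<open>lie.extend_basis {}\<close> is some basis of the whole space).\<close>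
definition endo_trace :: "('g::complex_lie_algebra \<Rightarrow> 'g) \<Rightarrow> complex" where
  "endo_trace f = (\<Sum>b\<in>lie.extend_basis {}. lie.representation (lie.extend_basis {}) (f b) b)"

definition killing_form :: "'g::complex_lie_algebra \<Rightarrow> 'g \<Rightarrow> complex" where
  "killing_form x y = endo_trace (lie_bracket x \<circ> lie_bracket y)"

text \<open>Cartan subalgebra of a complex semisimple Lie algebra: a maximal abelian subalgebra all of
  whose elements are ad-diagonalizable, i.e. the eigenvectors of \<open>ad H\<close> span.\<close>
definition cartan_subalgebra :: "'g::complex_lie_algebra set \<Rightarrow> bool" where
  "cartan_subalgebra h \<longleftrightarrow>
     lie.subspace h \<and>
     (\<forall>H\<in>h. \<forall>H'\<in>h. lie_bracket H H' = 0) \<and>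
     (\<forall>X. (\<forall>H\<in>h. lie_bracket H X = 0) \<longrightarrow> X \<in> h) \<and>
     (\<forall>H\<in>h. lie.span {X. \<exists>c. lie_bracket H X = c *\<^sub>C X} = UNIV)"


section \<open>Roots, Weyl chambers, fundamental weights\<close>

text \<open>A linear functional on the subspace \<open>h\<close> is represented by the function on the whole type
  that extends it by \<open>0\<close> outside \<open>h\<close>; this makes the representation unique and compatible with
  pointwise sums and multiples.\<close>
definition lin_dual :: "'g::complex_lie_algebra set \<Rightarrow> ('g \<Rightarrow> complex) set" where
  "lin_dual h = {f. (\<forall>x\<in>h. \<forall>y\<in>h. f (x + y) = f x + f y) \<and>
                    (\<forall>c. \<forall>x\<in>h. f (c *\<^sub>C x) = c * f x) \<and>
                    (\<forall>x. x \<notin> h \<longrightarrow> f x = 0)}"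

definition root_space :: "'g::complex_lie_algebra set \<Rightarrow> ('g \<Rightarrow> complex) \<Rightarrow> 'g set" where
  "root_space h \<alpha> = {X. \<forall>H\<in>h. lie_bracket H X = \<alpha> H *\<^sub>C X}"

definition roots :: "'g::complex_lie_algebra set \<Rightarrow> ('g \<Rightarrow> complex) set" where
  "roots h = {\<alpha> \<in> lin_dual h. \<alpha> \<noteq> (\<lambda>_. 0) \<and> root_space h \<alpha> \<noteq> {0}}"

text \<open>The vector \<open>H\<^sub>\<xi>\<close> of \<open>h\<close> representing \<open>\<xi>\<close> through the Cartan--Killing form.\<close>
definition dual_vector :: "'g::complex_lie_algebra set \<Rightarrow> ('g \<Rightarrow> complex) \<Rightarrow> 'g" where
  "dual_vector h \<xi> = (THE Z. Z \<in> h \<and> (\<forall>H\<in>h. \<xi> H = killing_form Z H))"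

definition dual_form :: "'g::complex_lie_algebra set \<Rightarrow> ('g \<Rightarrow> complex) \<Rightarrow> ('g \<Rightarrow> complex) \<Rightarrow> complex" where
  "dual_form h \<xi> \<mu> = killing_form (dual_vector h \<xi>) (dual_vector h \<mu>)"

definition coroot :: "'g::complex_lie_algebra set \<Rightarrow> ('g \<Rightarrow> complex) \<Rightarrow> 'g \<Rightarrow> complex" where
  "coroot h \<alpha> = (\<lambda>H. 2 / dual_form h \<alpha> \<alpha> * \<alpha> H)"

definition real_cartan :: "'g::complex_lie_algebra set \<Rightarrow> 'g set" where
  "real_cartan h = {(\<Sum>\<alpha>\<in>roots h. complex_of_real (c \<alpha>) *\<^sub>C dual_vector h \<alpha>) | c. True}"

text \<open>Roots are real-valued on \<open>h\<^sub>\<real>\<close>, so \<^term>\<open>Re\<close> only converts the type. A chamber consists of the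
  points lying on the same side of every root hyperplane as some regular point \<open>R\<close>.\<close>
definition weyl_chamber :: "'g::complex_lie_algebra set \<Rightarrow> 'g set \<Rightarrow> bool" where
  "weyl_chamber h C \<longleftrightarrow>
     (\<exists>R\<in>real_cartan h. (\<forall>\<alpha>\<in>roots h. \<alpha> R \<noteq> 0) \<and>
        C = {H \<in> real_cartan h. \<forall>\<alpha>\<in>roots h. sgn (Re (\<alpha> H)) = sgn (Re (\<alpha> R))})"

definition positive_roots :: "'g::complex_lie_algebra set \<Rightarrow> 'g set \<Rightarrow> ('g \<Rightarrow> complex) set" where
  "positive_roots h C = {\<alpha> \<in> roots h. \<forall>H\<in>C. 0 < Re (\<alpha> H)}"

definition simple_roots :: "'g::complex_lie_algebra set \<Rightarrow> 'g set \<Rightarrow> ('g \<Rightarrow> complex) set" where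
  "simple_roots h C = {\<alpha> \<in> positive_roots h C.
     \<not> (\<exists>\<beta>\<in>positive_roots h C. \<exists>\<gamma>\<in>positive_roots h C. \<alpha> = (\<lambda>H. \<beta> H + \<gamma> H))}"

text \<open>\<open>\<omega> \<alpha>\<close> is the fundamental weight belonging to the simple root \<open>\<alpha>\<close>: the families are indexed
  by the simple roots themselves.\<close>
definition fundamental_weights ::
  "'g::complex_lie_algebra set \<Rightarrow> 'g set \<Rightarrow> (('g \<Rightarrow> complex) \<Rightarrow> ('g \<Rightarrow> complex)) \<Rightarrow> bool" where
  "fundamental_weights h C \<omega> \<longleftrightarrow>
     (\<forall>\<alpha>\<in>simple_roots h C. \<omega> \<alpha> \<in> lin_dual h \<and>
        (\<forall>\<beta>\<in>simple_roots h C. dual_form h (coroot h \<beta>) (\<omega> \<alpha>) = (if \<beta> = \<alpha> then 1 else 0)))"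


section \<open>Representations on \<open>\<complex>\<^sup>n\<close>\<close>

definition lie_representation :: "('g::complex_lie_algebra \<Rightarrow> complex^'n^'n) \<Rightarrow> bool" where
  "lie_representation \<rho> \<longleftrightarrow>
     (\<forall>X Y. \<rho> (X + Y) = \<rho> X + \<rho> Y) \<and>
     (\<forall>c X w. \<rho> (c *\<^sub>C X) *v w = c *s (\<rho> X *v w)) \<and>
     (\<forall>X Y. \<rho> (lie_bracket X Y) = \<rho> X ** \<rho> Y - \<rho> Y ** \<rho> X)"

text \<open>The space \<open>\<complex>\<^sup>n\<close> is nonzero because index types are nonempty.\<close>
definition irreducible_rep :: "('g::complex_lie_algebra \<Rightarrow> complex^'n^'n) \<Rightarrow> bool" where
  "irreducible_rep \<rho> \<longleftrightarrow> lie_representation \<rho> \<and>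
     (\<forall>W. vec.subspace W \<and> (\<forall>X. \<forall>w\<in>W. \<rho> X *v w \<in> W) \<longrightarrow> W = {0} \<or> W = UNIV)"

definition weight_space ::
  "'g::complex_lie_algebra set \<Rightarrow> ('g \<Rightarrow> complex^'n^'n) \<Rightarrow> ('g \<Rightarrow> complex) \<Rightarrow> (complex^'n) set" where
  "weight_space h \<rho> \<xi> = {w. \<forall>H\<in>h. \<rho> H *v w = \<xi> H *s w}"

definition highest_weight_vector ::
  "'g::complex_lie_algebra set \<Rightarrow> 'g set \<Rightarrow> ('g \<Rightarrow> complex^'n^'n) \<Rightarrow> ('g \<Rightarrow> complex) \<Rightarrow> complex^'n \<Rightarrow> bool"
  where
  "highest_weight_vector h C \<rho> \<mu> w \<longleftrightarrow>
     \<mu> \<in> lin_dual h \<and> w \<noteq> 0 \<and> w \<in> weight_space h \<rho> \<mu> \<and>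
     (\<forall>\<alpha>\<in>positive_roots h C. \<forall>X\<in>root_space h \<alpha>. \<rho> X *v w = 0)"

definition has_highest_weight ::
  "'g::complex_lie_algebra set \<Rightarrow> 'g set \<Rightarrow> ('g \<Rightarrow> complex^'n^'n) \<Rightarrow> ('g \<Rightarrow> complex) \<Rightarrow> bool" where
  "has_highest_weight h C \<rho> \<mu> \<longleftrightarrow> (\<exists>w. highest_weight_vector h C \<rho> \<mu> w)"

text \<open>A basis \<open>v 0, \<dots>, v N\<close> of \<open>\<complex>\<^sup>n\<close> each of whose members is a weight vector.\<close>
definition weight_basis ::
  "'g::complex_lie_algebra set \<Rightarrow> ('g \<Rightarrow> complex^'n^'n) \<Rightarrow> nat \<Rightarrow> (nat \<Rightarrow> complex^'n) \<Rightarrow> bool" where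
  "weight_basis h \<rho> N v \<longleftrightarrow>
     inj_on v {0..N} \<and> vec.independent (v ` {0..N}) \<and> vec.span (v ` {0..N}) = UNIV \<and>
     (\<forall>i\<le>N. \<exists>\<xi>\<in>lin_dual h. v i \<in> weight_space h \<rho> \<xi>)"

abbreviation linear_form :: "(complex^'n \<Rightarrow> complex) \<Rightarrow> bool" where
  "linear_form \<phi> \<equiv> Vector_Spaces.linear (*s) (*) \<phi>"

definition dual_basis :: "nat \<Rightarrow> (nat \<Rightarrow> complex^'n) \<Rightarrow> (nat \<Rightarrow> complex^'n \<Rightarrow> complex) \<Rightarrow> bool" where
  "dual_basis N v \<epsilon> \<longleftrightarrow>
     (\<forall>i\<le>N. linear_form (\<epsilon> i) \<and> (\<forall>j\<le>N. \<epsilon> i (v j) = (if i = j then 1 else 0)))"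


section \<open>The connected linear group with a given Lie algebra\<close>

definition matrix_exp :: "complex^'n^'n \<Rightarrow> complex^'n^'n" where
  "matrix_exp A = (\<Sum>k. (1 / fact k) *\<^sub>R (((**) A ^^ k) (mat 1)))"

definition lie_algebra_of :: "(complex^'n^'n) set \<Rightarrow> (complex^'n^'n) set" where
  "lie_algebra_of G = {A. \<forall>t::real. matrix_exp (t *\<^sub>R A) \<in> G}"

definition GL :: "(complex^'n^'n) monoid" where
  "GL = \<lparr>carrier = {A. invertible A}, mult = (**), one = mat 1\<rparr>"

text \<open>A connected closed subgroup of \<open>GL\<close> with Lie algebra \<open>L\<close>. For the image of a semisimple Lie
  algebra the connected Lie subgroup it determines is automatically closed.\<close>
definition connected_linear_group :: "(complex^'n^'n) set \<Rightarrow> (complex^'n^'n) set \<Rightarrow> bool" where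
  "connected_linear_group G L \<longleftrightarrow>
     subgroup G GL \<and> closedin (top_of_set (carrier GL)) G \<and> connected G \<and> lie_algebra_of G = L"

abbreviation group_of :: "(complex^'n^'n) set \<Rightarrow> (complex^'n^'n) monoid" where
  "group_of G \<equiv> GL\<lparr>carrier := G\<rparr>"

text \<open>Adjoint action of a linear group with Lie algebra \<open>\<rho>(\<gg>)\<close>, transported to \<open>\<gg>\<close> by the
  faithful representation \<open>\<rho>\<close>.\<close>
definition Ad :: "('g::complex_lie_algebra \<Rightarrow> complex^'n^'n) \<Rightarrow> complex^'n^'n \<Rightarrow> 'g \<Rightarrow> 'g" where
  "Ad \<rho> g X = the_inv \<rho> (g ** \<rho> X ** matrix_inv g)"

definition centralizer ::
  "('g::complex_lie_algebra \<Rightarrow> complex^'n^'n) \<Rightarrow> (complex^'n^'n) set \<Rightarrow> 'g \<Rightarrow> (complex^'n^'n) set" where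
  "centralizer \<rho> G X = {g \<in> G. Ad \<rho> g X = X}"


section \<open>The action on \<open>V \<otimes> V\<^sup>*\<close>\<close>

definition dual_action :: "complex^'n^'n \<Rightarrow> (complex^'n \<Rightarrow> complex) \<Rightarrow> (complex^'n \<Rightarrow> complex)" where
  "dual_action g \<phi> = (\<lambda>w. \<phi> (matrix_inv g *v w))"

text \<open>\<open>V \<otimes> V\<^sup>*\<close> for \<open>V = \<complex>\<^sup>n\<close> is modelled by coefficient arrays: \<open>T $ i $ j\<close> is the coefficient of
  \<open>e\<^sub>i \<otimes> e\<^sub>j\<^sup>*\<close>, where \<open>e\<^sub>i\<close> is the standard basis and \<open>e\<^sub>j\<^sup>*\<close> its dual basis, the coordinate forms.\<close>
definition tensor :: "complex^'n \<Rightarrow> (complex^'n \<Rightarrow> complex) \<Rightarrow> complex^'n^'n" where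
  "tensor w \<phi> = (\<chi> i j. w $ i * \<phi> (axis j 1))"

text \<open>The linear extension of \<open>w \<otimes> \<phi> \<mapsto> g w \<otimes> g\<^sup>* \<phi>\<close>.\<close>
definition tensor_action :: "complex^'n^'n \<Rightarrow> complex^'n^'n \<Rightarrow> complex^'n^'n" where
  "tensor_action g T = (\<Sum>i\<in>UNIV. \<Sum>j\<in>UNIV.
     tensor ((T $ i $ j) *s (g *v axis i 1)) (dual_action g (\<lambda>w. w $ j)))"

lemma linear_form_coordinates:
  assumes "linear_form \<phi>"
  shows "\<phi> w = (\<Sum>j\<in>UNIV. w $ j * \<phi> (axis j 1))"
proof -
  interpret Vector_Spaces.linear "(*s)" "(*)" \<phi>
    by (fact assms)
  have "\<phi> w = \<phi> (\<Sum>j\<in>UNIV. (w $ j) *s axis j 1)"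
    by (simp add: basis_expansion)
  also have "\<dots> = (\<Sum>j\<in>UNIV. w $ j * \<phi> (axis j 1))"
    by (simp only: sum scale)
  finally show ?thesis .
qed

lemma tensor_action_tensor:
  assumes "linear_form \<phi>"
  shows "tensor_action g (tensor w \<phi>) = tensor (g *v w) (dual_action g \<phi>)"
proof -
  have 1: "(g *v w) $ k = (\<Sum>i\<in>UNIV. w $ i * (g *v axis i 1) $ k)" for k
    by (simp add: matrix_vector_mult_def axis_def if_distrib mult.commute cong: if_cong)
  have 2: "\<phi> (matrix_inv g *v axis l 1)
      = (\<Sum>j\<in>UNIV. (matrix_inv g *v axis l 1) $ j * \<phi> (axis j 1))" for l
    by (rule linear_form_coordinates[OF assms])
  show ?thesis
    by (simp add: vec_eq_iff tensor_action_def tensor_def dual_action_def 1 2 sum_product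
        mult_ac)
qed

end

theory Submission
  imports Defs
begin

text \<open>
  Let \<open>P\<close> be the operator \<open>w \<mapsto> \<epsilon>\<^sub>0(w) v\<^sub>0\<close>, that is, \<open>v\<^sub>0 \<otimes> \<epsilon>\<^sub>0\<close> regarded as a matrix.  The group acts on it by
  conjugation, so the isotropy group of the tensor consists of the \<open>g\<close> that commute with \<open>P\<close>, whereas the centralizer of
  \<open>H\<^sub>\<mu>\<close> consists of those that commute with \<open>\<rho>(H\<^sub>\<mu>)\<close>.

  If \<open>g\<close> commutes with \<open>P\<close>, then \<open>Ad g\<close> fixes \<open>H\<^sub>\<mu>\<close>, because \<open>H\<^sub>\<mu>\<close> is the moment image of \<open>P\<close>:
  \<open>K(H\<^sub>\<mu>, X) = \<epsilon>\<^sub>0(\<rho>(X) v\<^sub>0) = tr(P \<rho>(X))\<close> for all \<open>X\<close> (\<open>killing_form_H\<mu>\<close>).  The right hand side is unchanged when \<open>X\<close> is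
  replaced by \<open>Ad g\<^sup>-\<^sup>1 X\<close>, the Killing form \<open>K\<close> is invariant under the automorphism \<open>Ad g\<close>
  (\<open>killing_form_conjugate\<close>), and it is nondegenerate.

  If \<open>g\<close> commutes with \<open>\<rho>(H\<^sub>\<mu>)\<close>, it preserves the eigenspaces of this operator, and \<open>P\<close> is the projection onto the
  eigenspace for \<open>\<mu>(H\<^sub>\<mu>)\<close>: this eigenspace is the line of \<open>v\<^sub>0\<close>, and the other eigenvalues are \<open>\<mu>(H\<^sub>\<mu>) - r\<close> with
  \<open>r > 0\<close> (\<open>span_v_lower_eigenvectors\<close>).  The reason is representation theory of \<open>sl\<^sub>2\<close>.  For a positive root \<open>\<beta>\<close> and a
  vector \<open>X\<close> of root \<open>-\<beta>\<close>, the ladder \<open>X\<^sup>k v\<^sub>0\<close> is finite, and its length is a positive multiple of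
  \<open>\<beta>(H\<^sub>\<mu>)\<close> (\<open>negative_root_pairing\<close>).  So \<open>\<beta>(H\<^sub>\<mu>) \<ge> 0\<close>, and if it is \<open>0\<close> then \<open>X\<close> kills \<open>v\<^sub>0\<close>.  Thus a root
  vector either strictly lowers the eigenvalue of \<open>\<rho>(H\<^sub>\<mu>)\<close> or preserves the line of \<open>v\<^sub>0\<close>, and by irreducibility
  the lowering vectors produce all of \<open>V\<close> from \<open>v\<^sub>0\<close>.

  Both directions rest on the nondegeneracy of the Killing form of a Lie algebra without nonzero solvable ideals
  (\<open>killing_form_nondegenerate\<close>).  The Cartan subalgebra gives a short proof.  The radical of the form is spanned by its part in
  \<open>h\<close> and root vectors.  For a bracket \<open>t\<close> of opposite root vectors, \<open>K(t, t)\<close> is a positive multiple of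
  \<open>\<alpha>(t)\<^sup>2 \<noteq> 0\<close> unless \<open>t = 0\<close> (\<open>killing_form_bracket_opposite\<close>), so in the radical opposite root vectors
  commute.  The root vectors in the radical are thus closed under brackets, and the Engel-Jacobson theorem
  (\<open>engel_jacobson\<close>) produces from them an abelian ideal.
\<close>


section \<open>Eigenvectors, ladders and traces\<close>

context vector_space
begin

notation scale (infixr "\<cdot>" 75)

text \<open>Applying \<open>D - ev j\<close> removes the \<open>j\<close>-th component and multiplies the others by nonzero factors,
  so induction applies.  For \<open>U = {0}\<close> this is the linear independence of eigenvectors.\<close>
lemma eigencomponents_in_invariant_subspace:
  assumes D: "module_hom scale scale D" and U: "subspace U" and DU: "\<And>u. u \<in> U \<Longrightarrow> D u \<in> U"
    and "finite I" and "inj_on ev I" and "\<And>i. i \<in> I \<Longrightarrow> D (x i) = ev i \<cdot> x i"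
    and "(\<Sum>i\<in>I. x i) \<in> U" and "i \<in> I"
  shows "x i \<in> U"
  using assms(4-)
proof (induction I arbitrary: x i rule: finite_induct)
  case empty
  then show ?case by simp
next
  case (insert j I)
  interpret D: module_hom scale scale D by (rule D)
  let ?s = "\<Sum>i\<in>insert j I. x i"
  have "D ?s - ev j \<cdot> ?s = (\<Sum>i\<in>insert j I. (ev i - ev j) \<cdot> x i)"
    by (simp add: D.sum scale_sum_right scale_left_diff_distrib sum_subtractf insert.prems(2)
        del: sum.insert)
  also have "\<dots> = (\<Sum>i\<in>I. (ev i - ev j) \<cdot> x i)"
    using insert.hyps by simp
  finally have "(\<Sum>i\<in>I. (ev i - ev j) \<cdot> x i) \<in> U"
    using insert.prems(3) U DU subspace_diff subspace_scale by metis
  moreover have "D ((ev i - ev j) \<cdot> x i) = ev i \<cdot> ((ev i - ev j) \<cdot> x i)" if "i \<in> I" for i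
    using insert.prems(2)[of i] that by (simp add: D.scale mult.commute)
  ultimately have sc: "(ev i - ev j) \<cdot> x i \<in> U" if "i \<in> I" for i
    using insert.IH[of "\<lambda>i. (ev i - ev j) \<cdot> x i"] insert.prems(1) that by auto
  have xI: "x i \<in> U" if "i \<in> I" for i
  proof -
    have "ev i - ev j \<noteq> 0"
      using that insert.prems(1) insert.hyps by (auto simp: inj_on_def)
    then have "x i = inverse (ev i - ev j) \<cdot> ((ev i - ev j) \<cdot> x i)"
      by simp
    then show ?thesis using sc[OF that] U subspace_scale by metis
  qed
  have "x j = ?s - (\<Sum>i\<in>I. x i)"
    using insert.hyps by simp
  then have "x j \<in> U"
    using insert.prems(3) xI U subspace_diff subspace_sum by metis
  then show ?case using xI insert.prems(4) by auto
qed

lemma span_eigenvectors_decomposition: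
  assumes D: "module_hom scale scale D" and "x \<in> span {w. \<exists>c\<in>E. D w = c \<cdot> w}"
  obtains I y where "finite I" "I \<subseteq> E" "\<And>c. c \<in> I \<Longrightarrow> D (y c) = c \<cdot> y c" "x = (\<Sum>c\<in>I. y c)"
proof -
  interpret D: module_hom scale scale D by (rule D)
  have "\<exists>I y. finite I \<and> I \<subseteq> E \<and> (\<forall>c\<in>I. D (y c) = c \<cdot> y c) \<and> x = (\<Sum>c\<in>I. y c)"
    using assms(2)
  proof (induction rule: span_induct_alt)
    case base
    have "finite {} \<and> {} \<subseteq> E \<and> (\<forall>c\<in>{}. D (undefined c) = c \<cdot> undefined c)
        \<and> 0 = (\<Sum>c\<in>{}. undefined c)"
      by simp
    then show ?case by blast
  next
    case (step a w z)
    then obtain e I y where e: "e \<in> E" "D w = e \<cdot> w" and I: "finite I" "I \<subseteq> E" "\<forall>c\<in>I. D (y c) = c \<cdot> y c"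
      "z = (\<Sum>c\<in>I. y c)"
      by blast
    define y' where "y' = (\<lambda>c. (if c \<in> I then y c else 0) + (if c = e then a \<cdot> w else 0))"
    have "(\<Sum>c\<in>insert e I. y' c) = a \<cdot> w + z"
    proof -
      have "(\<Sum>c\<in>insert e I. y' c) = (\<Sum>c\<in>insert e I. if c \<in> I then y c else 0)
          + (\<Sum>c\<in>insert e I. if c = e then a \<cdot> w else 0)"
        by (simp only: y'_def sum.distrib)
      also have "(\<Sum>c\<in>insert e I. if c \<in> I then y c else 0) = z"
        using I by (cases "e \<in> I") (auto simp: insert_absorb intro: sum.cong)
      finally show ?thesis using I(1) by simp
    qed
    moreover have "\<forall>c\<in>insert e I. D (y' c) = c \<cdot> y' c"
      using I(3) e(2) by (auto simp: y'_def D.add D.scale D.zero scale_right_distrib mult.commute)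
    ultimately show ?case
      using I(1,2) e(1) by (intro exI[of _ "insert e I"] exI[of _ y']) auto
  qed
  then show thesis using that by blast
qed

text \<open>The vectors \<open>y\<^sup>k z\<close> are eigenvectors of \<open>D\<close> for the pairwise distinct eigenvalues \<open>b + k a\<close>,
  hence linearly independent as long as they are nonzero.\<close>
lemma ladder_terminates:
  fixes a :: 'a
  assumes D: "module_hom scale scale D" and char0: "inj (of_nat :: nat \<Rightarrow> 'a)"
    and fin: "finite B" "span B = UNIV"
    and comm: "\<And>w. D (y w) = y (D w) + a \<cdot> y w" and ysc: "\<And>c w. y (c \<cdot> w) = c \<cdot> y w"
    and "a \<noteq> 0" and z: "D z = b \<cdot> z"
  shows "\<exists>k. (y ^^ k) z = 0"
proof (rule ccontr)
  assume *: "\<not> (\<exists>k. (y ^^ k) z = 0)"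
  interpret D: module_hom scale scale D by (rule D)
  define ev where "ev k = b + of_nat k * a" for k :: nat
  have ev: "D ((y ^^ k) z) = ev k \<cdot> (y ^^ k) z" for k
  proof (induction k)
    case (Suc k)
    have "D ((y ^^ Suc k) z) = ev k \<cdot> y ((y ^^ k) z) + a \<cdot> y ((y ^^ k) z)"
      by (simp add: comm Suc.IH ysc)
    then show ?case by (simp add: ev_def algebra_simps)
  qed (simp add: z ev_def)
  have inj_ev: "inj ev"
    using char0 \<open>a \<noteq> 0\<close> by (auto simp: ev_def inj_def)
  have inj_y: "inj (\<lambda>k. (y ^^ k) z)"
  proof (rule injI)
    fix k l assume eq: "(y ^^ k) z = (y ^^ l) z"
    then have "ev k \<cdot> (y ^^ k) z = ev l \<cdot> (y ^^ k) z"
      using ev[of k] ev[of l] by metis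
    then show "k = l" using * inj_ev by (auto simp: inj_def)
  qed
  have "independent (range (\<lambda>k. (y ^^ k) z))"
    unfolding independent_explicit_finite_subsets
  proof (intro allI impI)
    fix A u assume A: "A \<subseteq> range (\<lambda>k. (y ^^ k) z)" "finite A" "(\<Sum>v\<in>A. u v \<cdot> v) = 0"
    then obtain K where K: "A = (\<lambda>k. (y ^^ k) z) ` K" by (auto simp: subset_image_iff)
    have "finite K"
      using A(2) K inj_y by (metis finite_imageD inj_on_subset subset_UNIV)
    have sum0: "(\<Sum>k\<in>K. u ((y ^^ k) z) \<cdot> (y ^^ k) z) \<in> {0}"
      using A(3) K inj_y by (simp add: sum.reindex inj_on_subset[OF _ subset_UNIV])
    have "u ((y ^^ k) z) \<cdot> (y ^^ k) z \<in> {0}" if "k \<in> K" for k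
      by (rule eigencomponents_in_invariant_subspace[OF D _ _ \<open>finite K\<close> _ _ sum0 that, of ev])
        (use inj_ev in \<open>auto simp: subspace_single_0 D.zero D.scale ev mult.commute intro: inj_on_subset\<close>)
    then show "\<forall>v\<in>A. u v = 0" using * K by auto
  qed
  then have "finite (range (\<lambda>k. (y ^^ k) z))"
    using independent_span_bound[OF fin(1)] fin(2) by auto
  then show False using inj_y by (simp add: range_inj_infinite)
qed

text \<open>The \<open>sl\<^sub>2\<close> computation: \<open>x y\<^sup>k\<^sup>+\<^sup>1 z = (\<Sum>j\<le>k. m - j a) y\<^sup>k z\<close> for a vector \<open>z\<close> of weight \<open>m\<close> killed
  by \<open>x\<close>, and at the end of the ladder the coefficient has to vanish.\<close>
lemma highest_weight_of_finite_ladder: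
  assumes comm: "\<And>w. x (y w) = y (x w) + t w" and ty: "\<And>w. t (y w) = y (t w) - a \<cdot> y w"
    and ysc: "\<And>c w. y (c \<cdot> w) = c \<cdot> y w" and x0: "x 0 = 0"
    and z: "x z = 0" "t z = m \<cdot> z" "z \<noteq> 0" and fin: "\<exists>k. (y ^^ k) z = 0"
  obtains k where "(y ^^ k) z \<noteq> 0" "(y ^^ Suc k) z = 0" "(\<Sum>j\<le>k. m - of_nat j * a) = 0"
proof -
  have tz: "t ((y ^^ k) z) = (m - of_nat k * a) \<cdot> (y ^^ k) z" for k
  proof (induction k)
    case (Suc k)
    have "t ((y ^^ Suc k) z) = (m - of_nat k * a) \<cdot> y ((y ^^ k) z) - a \<cdot> y ((y ^^ k) z)"
      by (simp add: ty Suc.IH ysc)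
    then show ?case by (simp add: algebra_simps)
  qed (simp add: z)
  have y0: "y 0 = 0" using ysc[of 0 0] by simp
  have xz: "x ((y ^^ Suc k) z) = (\<Sum>j\<le>k. m - of_nat j * a) \<cdot> (y ^^ k) z" for k
  proof (induction k)
    case 0
    then show ?case by (simp add: comm z y0)
  next
    case (Suc k)
    have "x ((y ^^ Suc (Suc k)) z) = y (x ((y ^^ Suc k) z)) + t ((y ^^ Suc k) z)"
      by (simp add: comm)
    also have "\<dots> = (\<Sum>j\<le>Suc k. m - of_nat j * a) \<cdot> (y ^^ Suc k) z"
      unfolding Suc.IH tz by (simp add: ysc scale_left_distrib)
    finally show ?case .
  qed
  define K where "K = (LEAST k. (y ^^ k) z = 0)"
  have K: "(y ^^ K) z = 0" unfolding K_def using fin by (rule LeastI_ex)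
  with z obtain k where k: "K = Suc k" by (cases K) auto
  then have nz: "(y ^^ k) z \<noteq> 0"
    unfolding K_def using not_less_Least[of k "\<lambda>k. (y ^^ k) z = 0"] by auto
  show thesis
  proof (rule that[OF nz])
    show "(y ^^ Suc k) z = 0" using K k by simp
    then show "(\<Sum>j\<le>k. m - of_nat j * a) = 0" using xz[of k] nz x0 by simp
  qed
qed

text \<open>With \<open>C = B\<close> this is \<open>tr (f \<circ> g) = tr (g \<circ> f)\<close>, with \<open>g = id\<close> it is the independence of the
  trace of the basis.\<close>
lemma trace_swap:
  assumes B: "finite B" "independent B" "span B = UNIV"
    and C: "finite C" "independent C" "span C = UNIV"
    and f: "module_hom scale scale f" and g: "module_hom scale scale g"
  shows "(\<Sum>b\<in>B. representation B (f (g b)) b) = (\<Sum>c\<in>C. representation C (g (f c)) c)"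
proof -
  interpret f: module_hom scale scale f by (rule f)
  interpret g: module_hom scale scale g by (rule g)
  have ex: "representation B' (h w) b = (\<Sum>c\<in>C'. representation C' w c * representation B' (h c) b)"
    if "module_hom scale scale h" "finite C'" "independent C'" "span C' = UNIV" "independent B'" "span B' = UNIV"
    for B' C' h w b
  proof -
    interpret h: module_hom scale scale h by (rule that)
    have "w = (\<Sum>c\<in>C'. representation C' w c \<cdot> c)"
      using sum_representation_eq[of C' w C'] that by simp
    then have "h w = (\<Sum>c\<in>C'. representation C' w c \<cdot> h c)"
      by (metis (mono_tags, lifting) h.sum h.scale sum.cong)
    then show ?thesis
      using that by (simp add: representation_sum representation_scale)
  qed
  have "(\<Sum>b\<in>B. representation B (f (g b)) b)
      = (\<Sum>b\<in>B. \<Sum>c\<in>C. representation C (g b) c * representation B (f c) b)"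
    by (intro sum.cong refl ex[OF f C B(2,3)])
  also have "\<dots> = (\<Sum>c\<in>C. \<Sum>b\<in>B. representation B (f c) b * representation C (g b) c)"
    by (subst sum.swap) (simp add: mult.commute)
  also have "\<dots> = (\<Sum>c\<in>C. representation C (g (f c)) c)"
    by (intro sum.cong refl ex[OF g B C(2,3), symmetric])
  finally show ?thesis .
qed

end


section \<open>The Killing form\<close>

lemma lie_bracket_zero [simp]: "lie_bracket (0::'g::complex_lie_algebra) x = 0" "lie_bracket x (0::'g) = 0"
  using lie_bracket_scaleC_left[of 0 0 x] lie_bracket_scaleC_right[of x 0 0] by simp_all

lemma lie_bracket_anticomm: "lie_bracket (x::'g::complex_lie_algebra) y = - lie_bracket y x"
proof -
  have "lie_bracket (x + y) (x + y) = lie_bracket x y + lie_bracket y x"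
    unfolding lie_bracket_add_left lie_bracket_add_right by (simp add: lie_bracket_self)
  then show ?thesis by (simp add: lie_bracket_self eq_neg_iff_add_eq_0)
qed

lemma lie_bracket_neg:
  "lie_bracket (- x) (y::'g::complex_lie_algebra) = - lie_bracket x y"
  "lie_bracket x (- y) = - lie_bracket x y"
  using lie_bracket_add_left[of x "- x" y] lie_bracket_add_right[of x y "- y"]
  by (simp_all add: eq_neg_iff_add_eq_0 add.commute)

lemma lie_bracket_commutator:
  "lie_bracket (lie_bracket x y) (z::'g::complex_lie_algebra)
    = lie_bracket x (lie_bracket y z) - lie_bracket y (lie_bracket x z)"
  using lie_jacobi[of x y z] lie_bracket_anticomm[of "lie_bracket x y" z] lie_bracket_anticomm[of z x]
  by (simp add: lie_bracket_neg algebra_simps add_eq_0_iff)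

lemma lie_bracket_derivation:
  "lie_bracket x (lie_bracket y (z::'g::complex_lie_algebra))
    = lie_bracket (lie_bracket x y) z + lie_bracket y (lie_bracket x z)"
  by (simp add: lie_bracket_commutator)

abbreviation lie_linear :: "('g::complex_lie_algebra \<Rightarrow> 'g) \<Rightarrow> bool" where
  "lie_linear \<equiv> module_hom scaleC scaleC"

lemma lie_linearI:
  assumes "\<And>x y. f (x + y) = f x + f y" "\<And>c x. f (c *\<^sub>C x) = c *\<^sub>C f x"
  shows "lie_linear f"
  by (rule module_hom.intro) (use assms in \<open>auto intro: lie.module_axioms simp: module_hom_axioms_def\<close>)

lemma lie_linear_ad: "lie_linear (lie_bracket x)"
  by (rule lie_linearI) (simp_all add: lie_bracket_add_right lie_bracket_scaleC_right)

lemma lie_linear_compose: "lie_linear f \<Longrightarrow> lie_linear g \<Longrightarrow> lie_linear (f \<circ> g)"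
  by (rule module_hom_compose)

lemma subspace_preimage_ad: "lie.subspace U \<Longrightarrow> lie.subspace {u. lie_bracket x u \<in> U}"
  by (rule module_hom.subspace_vimage[OF lie_linear_ad, of U x, unfolded vimage_def])

lemma ad_span_subset:
  assumes U: "lie.subspace U" and "\<And>x s. x \<in> X \<Longrightarrow> s \<in> S \<Longrightarrow> lie_bracket x s \<in> U"
    and "x \<in> lie.span X" "s \<in> lie.span S"
  shows "lie_bracket x s \<in> U"
proof -
  have 1: "lie_bracket x s \<in> U" if "x \<in> X" "s \<in> lie.span S" for x s
    using that(2) by (rule lie.span_induct) (use assms that in \<open>auto intro: subspace_preimage_ad\<close>)
  have "lie_bracket s x \<in> U" if "x \<in> lie.span X" "s \<in> lie.span S" for x s
    using that(1)
  proof (rule lie.span_induct)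
    fix y assume "y \<in> X"
    then have "- lie_bracket y s \<in> U" using 1 that U lie.subspace_neg by blast
    then show "lie_bracket s y \<in> U" by (simp add: lie_bracket_anticomm[of s y])
  qed (use U in \<open>rule subspace_preimage_ad\<close>)
  then have "- lie_bracket s x \<in> U" using assms U lie.subspace_neg by blast
  then show ?thesis by (simp add: lie_bracket_anticomm[of x s])
qed

lemma obtain_lie_spanning_set:
  obtains B :: "'g::complex_lie_algebra set" where "finite B" "lie.span B = UNIV"
proof -
  obtain B :: "'g set" where B: "finite B" "\<forall>x. \<exists>c. x = (\<Sum>b\<in>B. c b *\<^sub>C b)"
    using finite_dimensional by blast
  have "x \<in> lie.span B" for x
  proof -
    obtain c where "x = (\<Sum>b\<in>B. c b *\<^sub>C b)" using B by blast
    moreover have "\<dots> \<in> lie.span B" by (intro lie.span_sum lie.span_scale lie.span_base)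
    ultimately show ?thesis by simp
  qed
  then show ?thesis using that B by blast
qed

lemma lie_independent_finite: "lie.independent S \<Longrightarrow> finite S"
  using obtain_lie_spanning_set lie.independent_span_bound by (metis subset_UNIV)

lemma extend_basis_empty:
  "finite (lie.extend_basis {} :: 'g::complex_lie_algebra set)"
  "lie.independent (lie.extend_basis {} :: 'g set)" "lie.span (lie.extend_basis {} :: 'g set) = UNIV"
  using lie.independent_extend_basis[of "{} :: 'g set"] lie.span_extend_basis[of "{} :: 'g set"]
    lie_independent_finite by (auto simp: lie.independent_empty)

lemma endo_trace_comp_commute:
  "lie_linear f \<Longrightarrow> lie_linear g \<Longrightarrow> endo_trace (f \<circ> g) = endo_trace (g \<circ> f)"
  unfolding endo_trace_def o_def using extend_basis_empty by (intro lie.trace_swap) auto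

lemma endo_trace_eq_sum_basis:
  fixes B :: "'g::complex_lie_algebra set"
  assumes "finite B" "lie.independent B" "lie.span B = UNIV" "lie_linear f"
  shows "endo_trace f = (\<Sum>b\<in>B. lie.representation B (f b) b)"
  unfolding endo_trace_def
  using lie.trace_swap[OF extend_basis_empty assms(1-4) lie_linearI[of "\<lambda>x. x"]] by simp

lemma endo_trace_add:
  fixes f g :: "'g::complex_lie_algebra \<Rightarrow> 'g"
  shows "endo_trace (\<lambda>x. f x + g x) = endo_trace f + endo_trace g"
  unfolding endo_trace_def
  by (simp add: lie.representation_add extend_basis_empty sum.distrib)

lemma endo_trace_scale:
  fixes f :: "'g::complex_lie_algebra \<Rightarrow> 'g"
  shows "endo_trace (\<lambda>x. c *\<^sub>C f x) = c * endo_trace f"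
  unfolding endo_trace_def
  by (simp add: lie.representation_scale extend_basis_empty sum_distrib_left)

lemma killing_form_commute: "killing_form x y = killing_form y x"
  unfolding killing_form_def by (intro endo_trace_comp_commute lie_linear_ad)

lemma killing_form_add_left: "killing_form (x + y) z = killing_form x z + killing_form y z"
  unfolding killing_form_def o_def lie_bracket_add_left by (rule endo_trace_add)

lemma killing_form_scale_left: "killing_form (c *\<^sub>C x) z = c * killing_form x z"
  unfolding killing_form_def o_def lie_bracket_scaleC_left by (rule endo_trace_scale)

lemma killing_form_add_right: "killing_form x (y + z) = killing_form x y + killing_form x z"
  by (metis killing_form_add_left killing_form_commute)

lemma killing_form_scale_right: "killing_form x (c *\<^sub>C z) = c * killing_form x z"
  by (metis killing_form_scale_left killing_form_commute)

lemma killing_form_zero [simp]: "killing_form 0 x = 0" "killing_form x 0 = 0"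
  using killing_form_scale_left[of 0 0 x] killing_form_scale_right[of x 0 0] by simp_all

lemma killing_form_neg: "killing_form (- x) y = - killing_form x y" "killing_form x (- y) = - killing_form x y"
  using killing_form_add_left[of x "- x" y] killing_form_add_right[of x y "- y"]
  by (simp_all add: eq_neg_iff_add_eq_0 add.commute)

lemma killing_form_diff_left: "killing_form (x - y) z = killing_form x z - killing_form y z"
  using killing_form_add_left[of x "- y" z] by (simp add: killing_form_neg)

lemma killing_form_sum_left: "killing_form (\<Sum>i\<in>I. f i) y = (\<Sum>i\<in>I. killing_form (f i) y)"
  by (induction I rule: infinite_finite_induct) (simp_all add: killing_form_add_left)

lemma subspace_killing_orthogonal: "lie.subspace {x. killing_form y x = 0}"
  by (auto simp: lie.subspace_def killing_form_add_right killing_form_scale_right)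

lemma killing_form_invariant:
  "killing_form (lie_bracket x y) z = killing_form x (lie_bracket y z)"
proof -
  let ?a = "lie_bracket x" and ?b = "lie_bracket y" and ?c = "lie_bracket z"
  have *: "endo_trace (\<lambda>w. f w - g w) = endo_trace f - endo_trace g" for f g :: "'a \<Rightarrow> 'a"
    using endo_trace_add[of "\<lambda>w. f w - g w" g] by simp
  have "killing_form (lie_bracket x y) z = endo_trace (?a \<circ> ?b \<circ> ?c) - endo_trace (?b \<circ> (?a \<circ> ?c))"
    by (simp add: killing_form_def o_def lie_bracket_commutator *)
  also have "endo_trace (?b \<circ> (?a \<circ> ?c)) = endo_trace ((?a \<circ> ?c) \<circ> ?b)"
    by (intro endo_trace_comp_commute lie_linear_ad lie_linear_compose)
  also have "endo_trace (?a \<circ> ?b \<circ> ?c) - \<dots> = killing_form x (lie_bracket y z)"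
    by (simp add: killing_form_def o_def lie_bracket_commutator * lie_bracket_add_right
        module_hom.diff[OF lie_linear_ad])
  finally show ?thesis .
qed

lemma killing_form_automorphism:
  assumes "lie_linear f" "bij f" and br: "\<And>x y. f (lie_bracket x y) = lie_bracket (f x) (f y)"
  shows "killing_form (f x) (f y) = killing_form x y"
proof -
  let ?i = "inv_into UNIV f"
  have fi: "f (?i z) = z" "?i (f z) = z" for z
    using \<open>bij f\<close> by (simp_all add: bij_is_surj surj_f_inv_f bij_is_inj)
  interpret f: module_hom scaleC scaleC f by fact
  have i: "lie_linear ?i"
    by (rule lie_linearI; rule injD[OF bij_is_inj[OF \<open>bij f\<close>]])
      (simp_all add: fi f.add f.scale)
  have "killing_form (f x) (f y) = endo_trace (f \<circ> (lie_bracket x \<circ> lie_bracket y \<circ> ?i))"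
    unfolding killing_form_def by (rule arg_cong[where f = endo_trace]) (auto simp: br fi)
  also have "\<dots> = endo_trace ((lie_bracket x \<circ> lie_bracket y \<circ> ?i) \<circ> f)"
    by (intro endo_trace_comp_commute lie_linear_compose lie_linear_ad assms i)
  also have "\<dots> = killing_form x y"
    unfolding killing_form_def by (rule arg_cong[where f = endo_trace]) (auto simp: fi)
  finally show ?thesis .
qed


section \<open>Nilpotent families of operators\<close>

inductive_set ad_orbit :: "'g::complex_lie_algebra set \<Rightarrow> 'g \<Rightarrow> 'g set" for T w where
  ad_orbit_base: "w \<in> ad_orbit T w"
| ad_orbit_step: "z \<in> ad_orbit T w \<Longrightarrow> t \<in> T \<Longrightarrow> lie_bracket t z \<in> ad_orbit T w"

lemma ad_orbit_mono: "z \<in> ad_orbit T w \<Longrightarrow> T \<subseteq> T' \<Longrightarrow> z \<in> ad_orbit T' w"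
  by (induction rule: ad_orbit.induct) (auto intro: ad_orbit.intros)

lemma ad_orbit_subset: "z \<in> ad_orbit T w \<Longrightarrow> w \<in> M \<Longrightarrow> (\<And>t m. t \<in> T \<Longrightarrow> m \<in> M \<Longrightarrow> lie_bracket t m \<in> M) \<Longrightarrow> z \<in> M"
  by (induction rule: ad_orbit.induct) auto

text \<open>Some member of every orbit is annihilated modulo any stable subspace: this is the form of
  nilpotency that survives adjoining one more operator.\<close>
definition jointly_ad_nilpotent :: "'g::complex_lie_algebra set \<Rightarrow> bool" where
  "jointly_ad_nilpotent T \<longleftrightarrow>
     (\<forall>U w. lie.subspace U \<and> (\<forall>t\<in>T. \<forall>u\<in>U. lie_bracket t u \<in> U) \<and> w \<notin> U \<longrightarrow>
        (\<exists>w'\<in>ad_orbit T w. w' \<notin> U \<and> (\<forall>t\<in>T. lie_bracket t w' \<in> U)))"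

lemma jointly_ad_nilpotentE:
  assumes "jointly_ad_nilpotent T" "lie.subspace U" "\<And>t u. t \<in> T \<Longrightarrow> u \<in> U \<Longrightarrow> lie_bracket t u \<in> U" "w \<notin> U"
  obtains w' where "w' \<in> ad_orbit T w" "w' \<notin> U" "\<And>t. t \<in> T \<Longrightarrow> lie_bracket t w' \<in> U"
  using assms unfolding jointly_ad_nilpotent_def by blast

text \<open>The vectors sent into \<open>U\<close> by all of \<open>T\<close> are stable under \<open>ad A\<close>, because \<open>A\<close> normalizes the span of
  \<open>T\<close>.  Starting from such a vector outside \<open>U\<close>, the last power of \<open>ad A\<close> that stays outside \<open>U\<close> gives the
  required one.\<close>
lemma jointly_ad_nilpotent_insert:
  assumes T: "jointly_ad_nilpotent T" and A: "\<And>t. t \<in> T \<Longrightarrow> lie_bracket t A \<in> lie.span T"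
    and nil: "\<And>w. \<exists>k. (lie_bracket A ^^ k) w = 0"
  shows "jointly_ad_nilpotent (insert A T)"
  unfolding jointly_ad_nilpotent_def
proof (intro allI impI, elim conjE)
  fix U w
  assume U: "lie.subspace U" "\<forall>t\<in>insert A T. \<forall>u\<in>U. lie_bracket t u \<in> U" and "w \<notin> U"
  then obtain w1 where w1: "w1 \<in> ad_orbit T w" "w1 \<notin> U" "\<And>t. t \<in> T \<Longrightarrow> lie_bracket t w1 \<in> U"
    by (elim jointly_ad_nilpotentE[OF T]) auto
  define w' where "w' k = (lie_bracket A ^^ k) w1" for k
  have orb: "w' k \<in> ad_orbit (insert A T) w" for k
    by (induction k) (auto simp: w'_def intro: ad_orbit_step ad_orbit_mono[OF w1(1)])
  have stab: "\<forall>t\<in>T. lie_bracket t (w' k) \<in> U" for k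
  proof (induction k)
    case (Suc k)
    show ?case
    proof
      fix t assume t: "t \<in> T"
      have "lie_bracket (lie_bracket t A) (w' k) \<in> U"
        by (rule ad_span_subset[OF U(1) _ A[OF t] lie.span_base[of _ "{w' k}"]]) (use Suc in auto)
      moreover have "lie_bracket A (lie_bracket t (w' k)) \<in> U"
        using U(2) Suc t by auto
      moreover have "w' (Suc k) = lie_bracket A (w' k)" by (simp add: w'_def)
      ultimately show "lie_bracket t (w' (Suc k)) \<in> U"
        using U(1) by (simp add: lie_bracket_derivation[of t A] lie.subspace_add)
    qed
  qed (simp add: w'_def w1)
  have ex: "\<exists>k. w' k \<in> U"
    using nil[of w1] U(1) lie.subspace_0 by (metis w'_def)
  define K where "K = (LEAST k. w' k \<in> U)"
  have K: "w' K \<in> U" unfolding K_def using ex by (rule LeastI_ex)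
  moreover have "w' 0 \<notin> U" using w1 by (simp add: w'_def)
  ultimately obtain k where k: "K = Suc k" by (cases K) auto
  then have "w' k \<notin> U" unfolding K_def using not_less_Least[of k "\<lambda>k. w' k \<in> U"] by auto
  moreover have "lie_bracket A (w' k) \<in> U" using K k by (simp add: w'_def)
  ultimately show "\<exists>w'\<in>ad_orbit (insert A T) w. w' \<notin> U \<and> (\<forall>t\<in>insert A T. lie_bracket t w' \<in> U)"
    using orb[of k] stab[of k] by blast
qed

text \<open>Jacobson's form of Engel's theorem.  A maximal independent jointly nilpotent subset \<open>T\<close> whose
  span is closed under brackets spans all of \<open>M\<close>: otherwise joint nilpotency modulo the span of \<open>T\<close> produces an
  element of \<open>M\<close> that normalizes this span and can be adjoined.\<close>
lemma engel_jacobson: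
  fixes M :: "'g::complex_lie_algebra set"
  assumes M: "\<And>x y. x \<in> M \<Longrightarrow> y \<in> M \<Longrightarrow> lie_bracket x y \<in> M"
    and nil: "\<And>x w. x \<in> M \<Longrightarrow> \<exists>k. (lie_bracket x ^^ k) w = 0"
    and "z \<in> M" "z \<noteq> 0"
  obtains z' where "z' \<in> M" "z' \<noteq> 0" "\<And>x. x \<in> M \<Longrightarrow> lie_bracket x z' = 0"
proof -
  define good where "good T \<longleftrightarrow> T \<subseteq> M \<and> lie.independent T
    \<and> (\<forall>x\<in>T. \<forall>y\<in>T. lie_bracket x y \<in> lie.span T) \<and> jointly_ad_nilpotent T" for T
  obtain B :: "'g set" where B: "finite B" "lie.span B = UNIV"
    by (rule obtain_lie_spanning_set)
  have "good {}"
    by (auto simp: good_def jointly_ad_nilpotent_def lie.independent_empty intro: ad_orbit_base)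
  moreover have "\<forall>T. good T \<longrightarrow> card T \<le> card B"
    using lie.independent_span_bound[OF B(1)] B(2) by (auto simp: good_def)
  ultimately obtain T where T: "good T" "\<And>T'. good T' \<Longrightarrow> card T' \<le> card T"
    using ex_has_greatest_nat[of good "{}" card "Suc (card B)"] by (auto simp: less_Suc_eq_le)
  have TM: "T \<subseteq> M" and nilT: "jointly_ad_nilpotent T" and "finite T"
    using T(1) by (auto simp: good_def lie_independent_finite)
  have spanT: "lie_bracket t u \<in> lie.span T" if "t \<in> T" "u \<in> lie.span T" for t u
    by (rule ad_span_subset[OF lie.subspace_span _ lie.span_base[OF that(1)] that(2)])
      (use T in \<open>auto simp: good_def\<close>)
  have orbM: "w \<in> M" if "w \<in> ad_orbit T u" "u \<in> M" for u w
    using that by (rule ad_orbit_subset) (use M TM in auto)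
  have "M \<subseteq> lie.span T"
  proof
    fix A0 assume "A0 \<in> M"
    show "A0 \<in> lie.span T"
    proof (rule ccontr)
      assume "A0 \<notin> lie.span T"
      then obtain A where A: "A \<in> ad_orbit T A0" "A \<notin> lie.span T" "\<And>t. t \<in> T \<Longrightarrow> lie_bracket t A \<in> lie.span T"
        using jointly_ad_nilpotentE[OF nilT lie.subspace_span spanT] by metis
      have "A \<in> M" using A(1) \<open>A0 \<in> M\<close> by (rule orbM)
      have sub: "lie.span T \<subseteq> lie.span (insert A T)" by (intro lie.span_mono) auto
      have "lie_bracket A t \<in> lie.span T" if "t \<in> T" for t
        using A(3) that lie_bracket_anticomm[of A t] by (simp add: lie.span_neg)
      then have "\<forall>x\<in>insert A T. \<forall>y\<in>insert A T. lie_bracket x y \<in> lie.span (insert A T)"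
        using sub A(3) T(1) by (auto simp: good_def lie_bracket_self lie.span_zero)
      moreover have "jointly_ad_nilpotent (insert A T)"
        using nilT A(3) nil[OF \<open>A \<in> M\<close>] by (intro jointly_ad_nilpotent_insert) auto
      ultimately have "good (insert A T)"
        using \<open>A \<in> M\<close> A(2) T(1) by (auto simp: good_def lie.independent_insert)
      moreover have "A \<notin> T" using A(2) lie.span_base by blast
      ultimately show False using T(2)[of "insert A T"] \<open>finite T\<close> by simp
    qed
  qed
  obtain z' where z': "z' \<in> ad_orbit T z" "z' \<notin> {0}" "\<And>t. t \<in> T \<Longrightarrow> lie_bracket t z' \<in> {0}"
    by (rule jointly_ad_nilpotentE[OF nilT lie.subspace_single_0, of z]) (use \<open>z \<noteq> 0\<close> in auto)
  show thesis
  proof (rule that)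
    show "z' \<in> M" using z'(1) \<open>z \<in> M\<close> by (rule orbM)
    show "lie_bracket x z' = 0" if "x \<in> M" for x
      using ad_span_subset[of "{0}" T "{z'}" x z'] z'(3) that \<open>M \<subseteq> lie.span T\<close>
      by (auto simp: lie.span_base)
  qed (use z' in auto)
qed


section \<open>Root space decomposition\<close>

lemma semisimple_abelian_ideal_trivial:
  fixes I :: "'g::complex_lie_algebra set"
  assumes "semisimple TYPE('g)" "lie_ideal I" and ab: "\<And>x y. x \<in> I \<Longrightarrow> y \<in> I \<Longrightarrow> lie_bracket x y = 0"
  shows "I = {0}"
proof -
  have "0 \<in> I" using \<open>lie_ideal I\<close> lie.subspace_0 by (auto simp: lie_ideal_def)
  then have "{lie_bracket x y | x y. x \<in> I \<and> y \<in> I} = {0}" using ab by force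
  then have "derived_series I (Suc 0) = {0}" by (simp add: lie.span_insert_0)
  then show ?thesis using assms(1,2) unfolding semisimple_def lie_solvable_def by blast
qed

lemma semisimple_center_trivial:
  fixes t :: "'g::complex_lie_algebra"
  assumes "semisimple TYPE('g)" and "\<And>y. lie_bracket t y = 0"
  shows "t = 0"
proof -
  let ?Z = "{t :: 'g. \<forall>y. lie_bracket t y = 0}"
  have "lie_bracket x t = 0" if "t \<in> ?Z" for x t
    using that lie_bracket_anticomm[of x t] by simp
  then have "lie_ideal ?Z"
    by (auto simp: lie_ideal_def lie.subspace_def lie_bracket_add_left lie_bracket_scaleC_left)
  then have "?Z = {0}" by (rule semisimple_abelian_ideal_trivial[OF assms(1)]) auto
  then show ?thesis using assms(2) by auto
qed

lemma subspace_root_space: "lie.subspace (root_space h \<alpha>)"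
  by (auto simp: root_space_def lie.subspace_def lie_bracket_add_right lie_bracket_scaleC_right
      scaleC_add_right scaleC_scaleC mult.commute)

lemma lin_dual_add: "\<alpha> \<in> lin_dual h \<Longrightarrow> \<beta> \<in> lin_dual h \<Longrightarrow> (\<lambda>H. \<alpha> H + \<beta> H) \<in> lin_dual h"
  by (auto simp: lin_dual_def algebra_simps)

lemma lin_dual_uminus: "\<alpha> \<in> lin_dual h \<Longrightarrow> (\<lambda>H. - \<alpha> H) \<in> lin_dual h"
  by (auto simp: lin_dual_def algebra_simps)

lemma lin_dual_eqI:
  assumes "\<alpha> \<in> lin_dual h" "\<beta> \<in> lin_dual h" "\<And>H. H \<in> h \<Longrightarrow> \<alpha> H = \<beta> H"
  shows "\<alpha> = \<beta>"
proof (rule ext)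
  show "\<alpha> H = \<beta> H" for H
    using assms by (cases "H \<in> h") (simp_all add: lin_dual_def)
qed

lemma root_space_bracket:
  assumes "x \<in> root_space h \<alpha>" "y \<in> root_space h \<beta>"
  shows "lie_bracket x y \<in> root_space h (\<lambda>H. \<alpha> H + \<beta> H)"
  using assms
  by (auto simp: root_space_def lie_bracket_derivation lie_bracket_scaleC_left lie_bracket_scaleC_right
      scaleC_add_left)

lemma killing_form_root_spaces_orthogonal:
  assumes "x \<in> root_space h \<alpha>" "y \<in> root_space h \<beta>" "H \<in> h" "\<alpha> H + \<beta> H \<noteq> 0"
  shows "killing_form x y = 0"
proof -
  have "\<alpha> H * killing_form x y = killing_form (lie_bracket H x) y"
    using assms by (simp add: root_space_def killing_form_scale_left)
  also have "\<dots> = - killing_form x (lie_bracket H y)"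
    by (simp add: lie_bracket_anticomm[of H x] killing_form_neg killing_form_invariant)
  also have "\<dots> = - \<beta> H * killing_form x y"
    using assms by (simp add: root_space_def killing_form_scale_right)
  finally have "(\<alpha> H + \<beta> H) * killing_form x y = 0"
    by (simp add: algebra_simps)
  then show ?thesis using assms(4) by simp
qed

lemma sum_arithmetic_progression_eq_0:
  fixes m a :: complex
  assumes "(\<Sum>j\<le>k. m - of_nat j * a) = 0"
  shows "m = of_real (real k / 2) * a"
proof -
  have "2 * (\<Sum>j\<le>k. m - of_nat j * a) = of_nat (Suc k) * (2 * m - of_nat k * a)"
    by (induction k) (simp_all add: algebra_simps)
  then have "2 * m - of_nat k * a = 0"
    using assms by (metis mult_eq_0_iff mult_zero_right of_nat_eq_0_iff nat.distinct(1))
  then show ?thesis by (simp add: field_simps)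
qed

locale semisimple_cartan =
  fixes h :: "'g::complex_lie_algebra set"
  assumes semisimple: "semisimple TYPE('g)" and cartan: "cartan_subalgebra h"
begin

lemma subspace_h: "lie.subspace h"
  and h_abelian: "H \<in> h \<Longrightarrow> H' \<in> h \<Longrightarrow> lie_bracket H H' = 0"
  and h_self_centralizing: "(\<And>H. H \<in> h \<Longrightarrow> lie_bracket H X = 0) \<Longrightarrow> X \<in> h"
  and h_diagonalizable: "H \<in> h \<Longrightarrow> lie.span {X. \<exists>c. lie_bracket H X = c *\<^sub>C X} = UNIV"
  using cartan unfolding cartan_subalgebra_def by blast+

lemma root_space_0: "root_space h (\<lambda>_. 0) = h"
  using h_abelian h_self_centralizing by (auto simp: root_space_def lie.scale_zero_left)

text \<open>Commuting diagonalizable operators are jointly diagonalizable: each joint eigenspace of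
  the operators treated so far is invariant under the next one, hence contains the
  eigencomponents of its members.\<close>
lemma span_joint_eigenvectors:
  assumes "finite F" "F \<subseteq> h"
  shows "lie.span {X. \<forall>H\<in>F. \<exists>c. lie_bracket H X = c *\<^sub>C X} = UNIV"
  using assms
proof (induction F rule: finite_induct)
  case (insert H F)
  let ?E = "{X. \<forall>H\<in>F. \<exists>c. lie_bracket H X = c *\<^sub>C X}"
  let ?E' = "{X. \<forall>H\<in>insert H F. \<exists>c. lie_bracket H X = c *\<^sub>C X}"
  have "?E \<subseteq> lie.span ?E'"
  proof
    fix X assume "X \<in> ?E"
    then have "\<forall>H\<in>F. \<exists>c. lie_bracket H X = c *\<^sub>C X" by blast
    from bchoice[OF this] obtain e where e: "\<And>H'. H' \<in> F \<Longrightarrow> lie_bracket H' X = e H' *\<^sub>C X"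
      by blast
    have X: "X \<in> lie.span {w. \<exists>c\<in>UNIV. lie_bracket H w = c *\<^sub>C w}"
      using h_diagonalizable[of H] insert.prems by simp
    obtain I y where I: "finite I" "\<And>c. c \<in> I \<Longrightarrow> lie_bracket H (y c) = c *\<^sub>C y c" "X = (\<Sum>c\<in>I. y c)"
      by (rule lie.span_eigenvectors_decomposition[OF lie_linear_ad X]) blast
    have "y c \<in> ?E'" if "c \<in> I" for c
    proof -
      have "lie_bracket H' (y c) = e H' *\<^sub>C y c" if "H' \<in> F" for H'
      proof -
        let ?U = "{Y. lie_bracket H' Y = e H' *\<^sub>C Y}"
        have stable: "lie_bracket H u \<in> ?U" if "u \<in> ?U" for u
          using that lie_bracket_derivation[of H' H u] h_abelian[of H' H] \<open>H' \<in> F\<close> insert.prems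
          by (auto simp: lie_bracket_scaleC_right)
        have sub: "lie.subspace ?U"
          by (auto simp: lie.subspace_def lie_bracket_add_right lie_bracket_scaleC_right
              scaleC_add_right scaleC_scaleC mult.commute)
        have sum: "(\<Sum>c\<in>I. y c) \<in> ?U"
          using e \<open>H' \<in> F\<close> I(3) by simp
        have "y c \<in> ?U"
          by (rule lie.eigencomponents_in_invariant_subspace[OF lie_linear_ad sub stable I(1) _ I(2) sum \<open>c \<in> I\<close>])
            auto
        then show ?thesis by simp
      qed
      then show ?thesis using I(2) that by blast
    qed
    then show "X \<in> lie.span ?E'"
      unfolding I(3) by (intro lie.span_sum lie.span_base)
  qed
  then have "lie.span ?E \<subseteq> lie.span ?E'"
    using lie.span_minimal lie.subspace_span by blast
  then show ?case using insert by auto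
qed simp

text \<open>A joint eigenvector of a finite spanning set of \<open>h\<close> is one for all of \<open>h\<close>, and its eigenvalues
  depend linearly on the element of \<open>h\<close>.\<close>
lemma span_root_spaces: "lie.span (\<Union>\<xi>\<in>lin_dual h. root_space h \<xi>) = UNIV"
proof -
  obtain F where F: "F \<subseteq> h" "lie.independent F" "h \<subseteq> lie.span F"
    using lie.maximal_independent_subset[of h] by metis
  let ?E = "{X. \<forall>H\<in>F. \<exists>c. lie_bracket H X = c *\<^sub>C X}"
  have "X \<in> lie.span (\<Union>\<xi>\<in>lin_dual h. root_space h \<xi>)" if "X \<in> ?E" for X
  proof (cases "X = 0")
    case False
    have eig: "\<exists>c. lie_bracket H X = c *\<^sub>C X" if "H \<in> lie.span F" for H
      using that
    proof (rule lie.span_induct)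
      show "lie.subspace {H. \<exists>c. lie_bracket H X = c *\<^sub>C X}"
        unfolding lie.subspace_def
      proof (intro conjI ballI allI)
        show "0 \<in> {H. \<exists>c. lie_bracket H X = c *\<^sub>C X}"
          using lie.scale_zero_left[of X] by (auto intro: exI[of _ 0])
      next
        fix H H' assume "H \<in> {H. \<exists>c. lie_bracket H X = c *\<^sub>C X}" "H' \<in> {H. \<exists>c. lie_bracket H X = c *\<^sub>C X}"
        then obtain c c' where "lie_bracket H X = c *\<^sub>C X" "lie_bracket H' X = c' *\<^sub>C X" by blast
        then have "lie_bracket (H + H') X = (c + c') *\<^sub>C X"
          by (simp add: lie_bracket_add_left scaleC_add_left)
        then show "H + H' \<in> {H. \<exists>c. lie_bracket H X = c *\<^sub>C X}" by blast
      next
        fix a H assume "H \<in> {H. \<exists>c. lie_bracket H X = c *\<^sub>C X}"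
        then obtain c where "lie_bracket H X = c *\<^sub>C X" by blast
        then have "lie_bracket (a *\<^sub>C H) X = (a * c) *\<^sub>C X"
          by (simp add: lie_bracket_scaleC_left scaleC_scaleC)
        then show "a *\<^sub>C H \<in> {H. \<exists>c. lie_bracket H X = c *\<^sub>C X}" by blast
      qed
    qed (use \<open>X \<in> ?E\<close> in auto)
    then have "\<forall>H\<in>h. \<exists>c. lie_bracket H X = c *\<^sub>C X" using F(3) by blast
    from bchoice[OF this] obtain e where e: "\<And>H. H \<in> h \<Longrightarrow> lie_bracket H X = e H *\<^sub>C X"
      by blast
    define \<xi> where "\<xi> H = (if H \<in> h then e H else 0)" for H
    have "e (H + H') = e H + e H'" if "H \<in> h" "H' \<in> h" for H H'
    proof -
      have "e (H + H') *\<^sub>C X = (e H + e H') *\<^sub>C X"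
        using e[of "H + H'"] e[OF that(1)] e[OF that(2)] that lie.subspace_add[OF subspace_h]
        by (simp add: lie_bracket_add_left scaleC_add_left)
      then show ?thesis using False lie.scale_right_imp_eq by blast
    qed
    moreover have "e (c *\<^sub>C H) = c * e H" if "H \<in> h" for H c
    proof -
      have "e (c *\<^sub>C H) *\<^sub>C X = lie_bracket (c *\<^sub>C H) X"
        using e[OF lie.subspace_scale[OF subspace_h that]] by (rule sym)
      also have "\<dots> = (c * e H) *\<^sub>C X"
        using e[OF that] by (simp only: lie_bracket_scaleC_left scaleC_scaleC)
      finally show ?thesis using False lie.scale_right_imp_eq by blast
    qed
    ultimately have "\<xi> \<in> lin_dual h"
      using lie.subspace_add[OF subspace_h] lie.subspace_scale[OF subspace_h]
      by (auto simp: lin_dual_def \<xi>_def)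
    moreover have "X \<in> root_space h \<xi>" using e by (auto simp: root_space_def \<xi>_def)
    ultimately show ?thesis by (intro lie.span_base) blast
  qed (simp add: lie.span_zero)
  then have "lie.span ?E \<subseteq> lie.span (\<Union>\<xi>\<in>lin_dual h. root_space h \<xi>)"
    using lie.span_minimal lie.subspace_span by blast
  then show ?thesis
    using span_joint_eigenvectors[OF lie_independent_finite[OF F(2)] F(1)] by auto
qed

lemma obtain_root_basis:
  obtains B wt where "finite B" "lie.independent B" "lie.span B = UNIV"
    "\<And>b. b \<in> B \<Longrightarrow> wt b \<in> lin_dual h" "\<And>b. b \<in> B \<Longrightarrow> b \<in> root_space h (wt b)"
proof -
  obtain B where B: "B \<subseteq> (\<Union>\<xi>\<in>lin_dual h. root_space h \<xi>)" "lie.independent B"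
    "(\<Union>\<xi>\<in>lin_dual h. root_space h \<xi>) \<subseteq> lie.span B"
    using lie.maximal_independent_subset by metis
  have "\<forall>b\<in>B. \<exists>\<xi>. \<xi> \<in> lin_dual h \<and> b \<in> root_space h \<xi>" using B(1) by blast
  from bchoice[OF this] obtain wt where "\<forall>b\<in>B. wt b \<in> lin_dual h \<and> b \<in> root_space h (wt b)"
    by blast
  moreover have "lie.span B = UNIV"
    using B(3) span_root_spaces lie.span_minimal[OF B(3) lie.subspace_span] by auto
  ultimately show ?thesis using that B(2) lie_independent_finite by blast
qed

text \<open>In a basis of root vectors the operators \<open>ad H\<close> are diagonal.\<close>
lemma killing_form_on_h:
  assumes B: "finite B" "lie.independent B" "lie.span B = UNIV" "\<And>b. b \<in> B \<Longrightarrow> b \<in> root_space h (wt b)"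
    and H: "H \<in> h" "H' \<in> h"
  shows "killing_form H H' = (\<Sum>b\<in>B. wt b H * wt b H')"
proof -
  have "killing_form H H' = (\<Sum>b\<in>B. lie.representation B ((lie_bracket H \<circ> lie_bracket H') b) b)"
    unfolding killing_form_def
    by (intro endo_trace_eq_sum_basis B lie_linear_compose lie_linear_ad)
  also have "\<dots> = (\<Sum>b\<in>B. wt b H * wt b H')"
  proof (rule sum.cong[OF refl])
    fix b assume b: "b \<in> B"
    then have "(lie_bracket H \<circ> lie_bracket H') b = (wt b H * wt b H') *\<^sub>C b"
      using B(4)[OF b] H by (simp add: root_space_def lie_bracket_scaleC_right scaleC_scaleC mult.commute)
    then show "lie.representation B ((lie_bracket H \<circ> lie_bracket H') b) b = wt b H * wt b H'"
      using B b by (simp add: lie.representation_scale lie.representation_basis)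
  qed
  finally show ?thesis .
qed

lemma ad_root_vector_nilpotent:
  assumes "x \<in> root_space h \<alpha>" "H \<in> h" "\<alpha> H \<noteq> 0"
  shows "\<exists>k. (lie_bracket x ^^ k) w = 0"
proof -
  have "lie_linear (lie_bracket x ^^ k)" for k
  proof (induction k)
    case (Suc k)
    show ?case unfolding funpow.simps by (rule lie_linear_compose[OF lie_linear_ad Suc])
  qed (simp add: lie_linearI)
  then interpret x: module_hom scaleC scaleC "lie_bracket x ^^ k" for k .
  have mono: "(lie_bracket x ^^ l) w = 0" if "(lie_bracket x ^^ k) w = 0" "k \<le> l" for k l w
  proof -
    have "(lie_bracket x ^^ l) w = (lie_bracket x ^^ (l - k)) ((lie_bracket x ^^ k) w)"
      using that(2) by (metis comp_apply funpow_add le_add_diff_inverse2)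
    then show ?thesis using that(1) x.zero by simp
  qed
  obtain B :: "'g set" where B: "finite B" "lie.span B = UNIV" by (rule obtain_lie_spanning_set)
  have "w \<in> lie.span {X. \<exists>c. lie_bracket H X = c *\<^sub>C X}" using h_diagonalizable[OF assms(2)] by simp
  then show ?thesis
  proof (rule lie.span_induct)
    show "lie.subspace {w. \<exists>k. (lie_bracket x ^^ k) w = 0}"
      unfolding lie.subspace_def
    proof (intro conjI ballI allI)
      fix u v assume "u \<in> {w. \<exists>k. (lie_bracket x ^^ k) w = 0}" "v \<in> {w. \<exists>k. (lie_bracket x ^^ k) w = 0}"
      then obtain k l where kl: "(lie_bracket x ^^ k) u = 0" "(lie_bracket x ^^ l) v = 0" by blast
      have "(lie_bracket x ^^ max k l) (u + v) = 0"
        unfolding x.add using mono[OF kl(1)] mono[OF kl(2)] by simp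
      then show "u + v \<in> {w. \<exists>k. (lie_bracket x ^^ k) w = 0}" by blast
    qed (auto simp: x.zero x.scale)
    fix z assume "z \<in> {X. \<exists>c. lie_bracket H X = c *\<^sub>C X}"
    then obtain c where c: "lie_bracket H z = c *\<^sub>C z" by blast
    show "\<exists>k. (lie_bracket x ^^ k) z = 0"
    proof (rule lie.ladder_terminates[OF lie_linear_ad _ B _ _ assms(3) c])
      show "lie_bracket H (lie_bracket x w) = lie_bracket x (lie_bracket H w) + \<alpha> H *\<^sub>C lie_bracket x w" for w
        using assms(1,2) by (simp add: lie_bracket_derivation[of H x] root_space_def
            lie_bracket_scaleC_left add.commute)
    qed (auto simp: inj_def lie_bracket_scaleC_right)
  qed
qed

lemma root_space_bracket_opposite:
  assumes "x \<in> root_space h \<alpha>" "y \<in> root_space h (\<lambda>H. - \<alpha> H)"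
  shows "lie_bracket x y \<in> h"
  using root_space_bracket[OF assms] root_space_0 by simp

text \<open>Going up a root string as far as possible and then down again, the \<open>sl\<^sub>2\<close> computation gives
  \<open>\<beta> t = (q / 2 - p) \<alpha> t\<close> for the numbers \<open>p\<close>, \<open>q\<close> of steps.\<close>
lemma root_string_proportional:
  assumes x: "x \<in> root_space h \<alpha>" and y: "y \<in> root_space h (\<lambda>H. - \<alpha> H)" and \<alpha>: "H \<in> h" "\<alpha> H \<noteq> 0"
    and z: "z \<in> root_space h \<beta>" "z \<noteq> 0"
  shows "\<exists>r :: real. \<beta> (lie_bracket x y) = of_real r * \<alpha> (lie_bracket x y)"
proof -
  define t where "t = lie_bracket x y"
  have t: "t \<in> h" unfolding t_def by (rule root_space_bracket_opposite[OF x y])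
  define w where "w k = (lie_bracket x ^^ k) z" for k
  have w: "lie_bracket t (w k) = (\<beta> t + of_nat k * \<alpha> t) *\<^sub>C w k" for k
  proof (induction k)
    case 0
    then show ?case using z t by (simp add: w_def root_space_def)
  next
    case (Suc k)
    have "lie_bracket t (w (Suc k)) = lie_bracket (lie_bracket t x) (w k) + lie_bracket x (lie_bracket t (w k))"
      by (simp add: w_def lie_bracket_derivation[of t x])
    also have "lie_bracket t x = \<alpha> t *\<^sub>C x" using x t by (simp add: root_space_def)
    finally show ?case
      unfolding Suc.IH lie_bracket_scaleC_left lie_bracket_scaleC_right
      by (simp add: w_def scaleC_add_left distrib_right add_ac)
  qed
  have ex: "\<exists>k. w k = 0" unfolding w_def by (rule ad_root_vector_nilpotent[OF x \<alpha>])
  define K where "K = (LEAST k. w k = 0)"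
  have K: "w K = 0" unfolding K_def using ex by (rule LeastI_ex)
  moreover have "w 0 \<noteq> 0" using z by (simp add: w_def)
  ultimately obtain p where p: "K = Suc p" by (cases K) auto
  then have "w p \<noteq> 0" unfolding K_def using not_less_Least[of p "\<lambda>k. w k = 0"] by auto
  obtain k where "(\<Sum>j\<le>k. \<beta> t + of_nat p * \<alpha> t - of_nat j * \<alpha> t) = 0"
  proof (rule lie.highest_weight_of_finite_ladder[of "lie_bracket x" "lie_bracket y" "lie_bracket t" "\<alpha> t" "w p"])
    show "lie_bracket x (lie_bracket y u) = lie_bracket y (lie_bracket x u) + lie_bracket t u" for u
      by (simp add: lie_bracket_derivation[of x y] t_def)
    show "lie_bracket t (lie_bracket y u) = lie_bracket y (lie_bracket t u) - \<alpha> t *\<^sub>C lie_bracket y u" for u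
      using y t by (simp add: lie_bracket_derivation[of t y] root_space_def lie_bracket_scaleC_left
          lie_bracket_neg)
    show "\<exists>k. (lie_bracket y ^^ k) (w p) = 0"
      by (rule ad_root_vector_nilpotent[OF y \<alpha>(1)]) (use \<alpha> in simp)
    show "lie_bracket x (w p) = 0" using K p by (simp add: w_def)
  qed (use w \<open>w p \<noteq> 0\<close> in \<open>auto simp: lie_bracket_scaleC_right\<close>)
  then have "\<beta> t + of_nat p * \<alpha> t = of_real (real k / 2) * \<alpha> t"
    by (rule sum_arithmetic_progression_eq_0)
  then have "\<beta> t = of_real (real k / 2 - real p) * \<alpha> t"
    by (simp add: algebra_simps)
  then show ?thesis unfolding t_def by blast
qed

text \<open>Since \<open>K t t = (\<Sum>b. r b\<^sup>2) (\<alpha> t)\<^sup>2\<close> with real factors \<open>r b\<close>, an isotropic \<open>t\<close> is annihilated by all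
  roots and thus central.\<close>
lemma killing_form_bracket_opposite:
  assumes x: "x \<in> root_space h \<alpha>" and y: "y \<in> root_space h (\<lambda>H. - \<alpha> H)" and \<alpha>: "H \<in> h" "\<alpha> H \<noteq> 0"
    and "lie_bracket x y \<noteq> 0"
  obtains R :: real where "R > 0" "\<alpha> (lie_bracket x y) \<noteq> 0"
    "killing_form (lie_bracket x y) (lie_bracket x y) = of_real R * (\<alpha> (lie_bracket x y))\<^sup>2"
proof -
  define t where "t = lie_bracket x y"
  have t: "t \<in> h" "t \<noteq> 0" unfolding t_def using root_space_bracket_opposite[OF x y] assms by auto
  obtain B wt where B: "finite B" "lie.independent B" "lie.span B = UNIV"
    "\<And>b. b \<in> B \<Longrightarrow> wt b \<in> lin_dual h" "\<And>b. b \<in> B \<Longrightarrow> b \<in> root_space h (wt b)"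
    using obtain_root_basis by blast
  have "\<forall>b\<in>B. \<exists>r :: real. wt b t = of_real r * \<alpha> t"
  proof
    fix b assume b: "b \<in> B"
    then have "b \<noteq> 0" using B(2) lie.dependent_zero by blast
    then show "\<exists>r :: real. wt b t = of_real r * \<alpha> t"
      unfolding t_def by (rule root_string_proportional[OF x y \<alpha> B(5)[OF b]])
  qed
  from bchoice[OF this] obtain r :: "'g \<Rightarrow> real" where r: "\<And>b. b \<in> B \<Longrightarrow> wt b t = of_real (r b) * \<alpha> t"
    by blast
  have "\<not> (\<forall>b\<in>B. wt b t = 0)"
  proof
    assume "\<forall>b\<in>B. wt b t = 0"
    then have "lie_bracket t b = 0" if "b \<in> B" for b
      using B(5)[OF that] t(1) that by (auto simp: root_space_def lie.scale_zero_left)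
    then have "lie_bracket t u \<in> {0}" for u
      using ad_span_subset[OF lie.subspace_single_0, of "{t}" B t u] B(3) by (auto simp: lie.span_base)
    then show False using semisimple_center_trivial[OF semisimple, of t] t(2) by auto
  qed
  then obtain b where b: "b \<in> B" "wt b t \<noteq> 0" by blast
  have "killing_form t t = (\<Sum>b\<in>B. (wt b t)\<^sup>2)"
    by (simp add: killing_form_on_h[OF B(1-3) B(5) t(1) t(1)] power2_eq_square)
  also have "\<dots> = of_real (\<Sum>b\<in>B. (r b)\<^sup>2) * (\<alpha> t)\<^sup>2"
    by (simp add: r sum_distrib_right power_mult_distrib)
  finally have "killing_form t t = of_real (\<Sum>b\<in>B. (r b)\<^sup>2) * (\<alpha> t)\<^sup>2" .
  moreover have "(\<Sum>b\<in>B. (r b)\<^sup>2) > 0"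
    using b r[OF b(1)] B(1) by (intro sum_pos2[of _ b]) auto
  moreover have "\<alpha> t \<noteq> 0" using b r[OF b(1)] by auto
  ultimately show ?thesis using that unfolding t_def by blast
qed

end


section \<open>Nondegeneracy of the Killing form\<close>

context semisimple_cartan
begin

lemma root_decomposition:
  obtains \<Xi> f where "finite \<Xi>" "\<Xi> \<subseteq> lin_dual h" "\<And>\<xi>. \<xi> \<in> \<Xi> \<Longrightarrow> f \<xi> \<in> root_space h \<xi>" "x = (\<Sum>\<xi>\<in>\<Xi>. f \<xi>)"
proof -
  obtain B wt where B: "finite B" "lie.independent B" "lie.span B = UNIV"
    "\<And>b. b \<in> B \<Longrightarrow> wt b \<in> lin_dual h" "\<And>b. b \<in> B \<Longrightarrow> b \<in> root_space h (wt b)"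
    using obtain_root_basis by blast
  let ?c = "\<lambda>b. lie.representation B x b *\<^sub>C b"
  show ?thesis
  proof (rule that)
    show "(\<Sum>b\<in>{b \<in> B. wt b = \<xi>}. ?c b) \<in> root_space h \<xi>" if "\<xi> \<in> wt ` B" for \<xi>
      using B(5) by (intro lie.subspace_sum lie.subspace_scale subspace_root_space) auto
    have "x = (\<Sum>b\<in>B. ?c b)"
      using lie.sum_representation_eq[of B x B] B by simp
    also have "\<dots> = (\<Sum>\<xi>\<in>wt ` B. \<Sum>b\<in>{b \<in> B. wt b = \<xi>}. ?c b)"
      using B(1) by (rule sum.image_gen)
    finally show "x = (\<Sum>\<xi>\<in>wt ` B. \<Sum>b\<in>{b \<in> B. wt b = \<xi>}. ?c b)" .
  qed (use B in auto)
qed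

lemma killing_form_zeroI:
  assumes "\<And>\<xi> y. \<xi> \<in> lin_dual h \<Longrightarrow> y \<in> root_space h \<xi> \<Longrightarrow> killing_form x y = 0"
  shows "killing_form x y = 0"
proof -
  have "y \<in> lie.span (\<Union>\<xi>\<in>lin_dual h. root_space h \<xi>)" using span_root_spaces by simp
  then show ?thesis
    by (rule lie.span_induct) (use assms subspace_killing_orthogonal in auto)
qed

lemma not_opposite_imp_sum_nonzero:
  assumes "\<alpha> \<in> lin_dual h" "\<beta> \<in> lin_dual h" "\<beta> \<noteq> (\<lambda>H. - \<alpha> H)"
  obtains H where "H \<in> h" "\<alpha> H + \<beta> H \<noteq> 0"
  using lin_dual_eqI[OF assms(2) lin_dual_uminus[OF assms(1)]] assms(3)
  by (metis add.inverse_unique add.commute neg_eq_iff_add_eq_0)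

lemma nonzero_weight:
  assumes "\<alpha> \<in> lin_dual h" "\<alpha> \<noteq> (\<lambda>_. 0)"
  obtains H where "H \<in> h" "\<alpha> H \<noteq> 0"
  using assms by (metis (mono_tags, lifting) lin_dual_def mem_Collect_eq)

text \<open>Let \<open>S\<close> be the radical of the form and \<open>M\<close> the set of the vectors of nonzero weight in it.  They are
  ad-nilpotent, and those of opposite weights commute because their bracket is isotropic.  So \<open>M\<close> is closed
  under brackets, and by Engel's theorem the ideal it spans has a nonzero centre, which is an
  abelian ideal, if \<open>M\<close> contains a nonzero vector.  Hence \<open>S\<close> lies in \<open>h\<close> and is itself an abelian ideal.\<close>
lemma killing_form_nondegenerate:
  fixes x :: 'g
  assumes "\<And>y. killing_form x y = 0"
  shows "x = 0"
proof -
  define S where "S = {x :: 'g. \<forall>y. killing_form x y = 0}"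
  have subS: "lie.subspace S"
    by (auto simp: S_def lie.subspace_def killing_form_add_left killing_form_scale_left)
  have S_br: "lie_bracket z x \<in> S" if "x \<in> S" for x z
    using that by (simp add: S_def lie_bracket_anticomm[of z x] killing_form_neg killing_form_invariant)
  have S_br': "lie_bracket x z \<in> S" if "x \<in> S" for x z
    using S_br[OF that, of z] lie.subspace_neg[OF subS] lie_bracket_anticomm[of x z] by simp
  have opp: "lie_bracket x y = 0"
    if asm: "x \<in> S" "x \<in> root_space h \<alpha>" "y \<in> root_space h (\<lambda>H. - \<alpha> H)" "\<alpha> \<in> lin_dual h" "\<alpha> \<noteq> (\<lambda>_. 0)" for x y \<alpha>
  proof (rule ccontr)
    assume nz: "lie_bracket x y \<noteq> 0"
    obtain H where H: "H \<in> h" "\<alpha> H \<noteq> 0" using nonzero_weight[OF asm(4,5)] by blast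
    obtain R :: real where "R > 0" "\<alpha> (lie_bracket x y) \<noteq> 0"
      "killing_form (lie_bracket x y) (lie_bracket x y) = of_real R * (\<alpha> (lie_bracket x y))\<^sup>2"
      using killing_form_bracket_opposite[OF asm(2,3) H nz] by blast
    then show False using S_br'[OF asm(1), of y] by (simp add: S_def)
  qed
  define M where "M = (\<Union>\<alpha>\<in>{\<alpha> \<in> lin_dual h. \<alpha> \<noteq> (\<lambda>_. 0)}. S \<inter> root_space h \<alpha>)"
  have M_br: "lie_bracket x y \<in> M" if "x \<in> M" "\<beta> \<in> lin_dual h" "y \<in> root_space h \<beta>" for x y \<beta>
  proof -
    obtain \<alpha> where \<alpha>: "\<alpha> \<in> lin_dual h" "\<alpha> \<noteq> (\<lambda>_. 0)" "x \<in> S" "x \<in> root_space h \<alpha>"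
      using \<open>x \<in> M\<close> by (auto simp: M_def)
    show ?thesis
    proof (cases "\<beta> = (\<lambda>H. - \<alpha> H)")
      case True
      then have "lie_bracket x y = 0" using opp \<alpha> that by blast
      then show ?thesis
        using \<alpha> lie.subspace_0[OF subS] lie.subspace_0[OF subspace_root_space, of h \<alpha>] by (auto simp: M_def)
    next
      case False
      then have "(\<lambda>H. \<alpha> H + \<beta> H) \<noteq> (\<lambda>_. 0)"
        by (metis neg_eq_iff_add_eq_0)
      then show ?thesis
        using \<alpha> that S_br' root_space_bracket[OF \<alpha>(4) that(3)] lin_dual_add[OF \<alpha>(1) that(2)]
        unfolding M_def by blast
    qed
  qed
  have M_ideal: "lie_bracket y n \<in> lie.span M" if "n \<in> lie.span M" for n y
  proof (rule ad_span_subset[OF lie.subspace_span _ _ that])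
    show "y \<in> lie.span (\<Union>\<xi>\<in>lin_dual h. root_space h \<xi>)" using span_root_spaces by simp
    show "lie_bracket x s \<in> lie.span M" if "x \<in> (\<Union>\<xi>\<in>lin_dual h. root_space h \<xi>)" "s \<in> M" for x s
    proof -
      have "lie_bracket s x \<in> M" using that M_br by blast
      then show ?thesis by (simp add: lie_bracket_anticomm[of x s] lie.span_neg lie.span_base)
    qed
  qed
  have M0: "z = 0" if "z \<in> M" for z
  proof (rule ccontr)
    assume "z \<noteq> 0"
    have "\<exists>k. (lie_bracket x ^^ k) w = 0" if x: "x \<in> M" for x w
    proof -
      obtain \<alpha> where \<alpha>: "\<alpha> \<in> lin_dual h" "\<alpha> \<noteq> (\<lambda>_. 0)" "x \<in> root_space h \<alpha>"
        using x by (auto simp: M_def)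
      then obtain H where "H \<in> h" "\<alpha> H \<noteq> 0" by (metis nonzero_weight)
      then show ?thesis using ad_root_vector_nilpotent[OF \<alpha>(3)] by blast
    qed
    moreover have "lie_bracket x y \<in> M" if "x \<in> M" "y \<in> M" for x y
      using that(2) M_br[OF that(1)] by (auto simp: M_def)
    ultimately obtain z' where z': "z' \<in> M" "z' \<noteq> 0" "\<And>x. x \<in> M \<Longrightarrow> lie_bracket x z' = 0"
      using engel_jacobson[OF _ _ \<open>z \<in> M\<close> \<open>z \<noteq> 0\<close>] by blast
    let ?I = "{m \<in> lie.span M. \<forall>x\<in>M. lie_bracket x m = 0}"
    have span_kill: "lie_bracket x m = 0" if "x \<in> lie.span M" "m \<in> ?I" for x m
      using ad_span_subset[OF lie.subspace_single_0, of M "{m}" x m] that by (auto simp: lie.span_base)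
    have "lie_bracket y m \<in> ?I" if "m \<in> ?I" for y m
    proof -
      have "lie_bracket x (lie_bracket y m) = 0" if x: "x \<in> M" for x
      proof -
        have "lie_bracket x y \<in> lie.span M"
          using M_ideal[OF lie.span_base[OF x], of y] lie_bracket_anticomm[of x y] by (simp add: lie.span_neg)
        then show ?thesis
          using span_kill[OF _ \<open>m \<in> ?I\<close>] x \<open>m \<in> ?I\<close> by (simp add: lie_bracket_derivation[of x y])
      qed
      then show ?thesis using M_ideal that by auto
    qed
    moreover have "lie.subspace ?I"
      by (auto simp: lie.subspace_def lie.span_zero lie.span_add lie.span_scale lie_bracket_add_right
          lie_bracket_scaleC_right)
    ultimately have "?I = {0}"
      using span_kill by (intro semisimple_abelian_ideal_trivial[OF semisimple]) (auto simp: lie_ideal_def)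
    moreover have "z' \<in> ?I" using z' by (auto simp: lie.span_base)
    ultimately show False using z' by auto
  qed
  have "S \<subseteq> h"
  proof
    fix x assume x: "x \<in> S"
    obtain \<Xi> f where f: "finite \<Xi>" "\<Xi> \<subseteq> lin_dual h" "\<And>\<xi>. \<xi> \<in> \<Xi> \<Longrightarrow> f \<xi> \<in> root_space h \<xi>"
      "x = (\<Sum>\<xi>\<in>\<Xi>. f \<xi>)"
      using root_decomposition by blast
    have "f \<xi> \<in> S" if "\<xi> \<in> \<Xi>" for \<xi>
    proof -
      have "killing_form (f \<xi>) y = 0" if y: "\<eta> \<in> lin_dual h" "y \<in> root_space h \<eta>" for \<eta> y
      proof -
        have orth: "killing_form (f \<xi>') y = 0" if \<xi>': "\<xi>' \<in> \<Xi>" "\<eta> \<noteq> (\<lambda>H. - \<xi>' H)" for \<xi>'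
        proof -
          obtain H where "H \<in> h" "\<xi>' H + \<eta> H \<noteq> 0"
            using not_opposite_imp_sum_nonzero[of \<xi>' \<eta>] f(2) \<xi>' y(1) by blast
          then show ?thesis using killing_form_root_spaces_orthogonal f(3)[OF \<xi>'(1)] y(2) by blast
        qed
        show ?thesis
        proof (cases "\<eta> = (\<lambda>H. - \<xi> H)")
          case True
          have "0 = killing_form x y" using x by (simp add: S_def)
          also have "\<dots> = (\<Sum>\<xi>'\<in>\<Xi>. killing_form (f \<xi>') y)"
            unfolding f(4) by (rule killing_form_sum_left)
          also have "\<dots> = (\<Sum>\<xi>'\<in>{\<xi>}. killing_form (f \<xi>') y)"
          proof (rule sum.mono_neutral_right[OF f(1)])
            show "\<forall>\<xi>'\<in>\<Xi> - {\<xi>}. killing_form (f \<xi>') y = 0"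
            proof
              fix \<xi>' assume "\<xi>' \<in> \<Xi> - {\<xi>}"
              moreover from this have "\<eta> \<noteq> (\<lambda>H. - \<xi>' H)" using True by (auto simp: fun_eq_iff eq_commute)
              ultimately show "killing_form (f \<xi>') y = 0" using orth by blast
            qed
          qed (use \<open>\<xi> \<in> \<Xi>\<close> in auto)
          finally show ?thesis by simp
        qed (use orth \<open>\<xi> \<in> \<Xi>\<close> in blast)
      qed
      then show ?thesis unfolding S_def using killing_form_zeroI by blast
    qed
    then have "f \<xi> = 0" if "\<xi> \<in> \<Xi>" "\<xi> \<noteq> (\<lambda>_. 0)" for \<xi>
      using that f(2,3) M0 unfolding M_def by blast
    then have "f \<xi> \<in> h" if "\<xi> \<in> \<Xi>" for \<xi>
      using that f(3)[OF that] root_space_0 lie.subspace_0[OF subspace_h] by metis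
    then show "x \<in> h" unfolding f(4) by (rule lie.subspace_sum[OF subspace_h])
  qed
  have "lie_ideal S" using S_br subS by (simp add: lie_ideal_def)
  then have "S = {0}"
    by (rule semisimple_abelian_ideal_trivial[OF semisimple]) (use h_abelian \<open>S \<subseteq> h\<close> in blast)
  moreover have "x \<in> S" using assms by (simp add: S_def)
  ultimately show ?thesis by simp
qed

lemma killing_form_eqI:
  fixes x y :: 'g
  shows "(\<And>z. killing_form x z = killing_form y z) \<Longrightarrow> x = y"
  using killing_form_nondegenerate[of "x - y"] by (simp add: killing_form_diff_left)

lemma killing_form_h_root_space:
  assumes "H \<in> h" "\<xi> \<in> lin_dual h" "\<xi> \<noteq> (\<lambda>_. 0)" "y \<in> root_space h \<xi>"
  shows "killing_form H y = 0"
proof -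
  obtain H' where "H' \<in> h" "\<xi> H' \<noteq> 0" using nonzero_weight assms by metis
  then show ?thesis
    using killing_form_root_spaces_orthogonal[of H h "\<lambda>_. 0" y \<xi> H'] assms root_space_0 by simp
qed

lemma killing_form_nondegenerate_on_h:
  assumes "Z \<in> h" "\<And>H. H \<in> h \<Longrightarrow> killing_form Z H = 0"
  shows "Z = 0"
proof (rule killing_form_nondegenerate, rule killing_form_zeroI)
  fix \<xi> y assume "\<xi> \<in> lin_dual h" "y \<in> root_space h \<xi>"
  then show "killing_form Z y = 0"
    using killing_form_h_root_space[OF assms(1)] assms(2) root_space_0 by metis
qed

text \<open>By nondegeneracy the map \<open>Z \<mapsto> (\<Sum>b\<in>F. K Z b b)\<close>, for a basis \<open>F\<close> of \<open>h\<close>, is an injective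
  endomorphism of \<open>h\<close>, hence onto; a preimage of \<open>\<Sum>b\<in>F. \<xi> b b\<close> represents \<open>\<xi>\<close>.\<close>
lemma dual_vector_exists:
  assumes "\<xi> \<in> lin_dual h"
  shows "\<exists>Z\<in>h. \<forall>H\<in>h. \<xi> H = killing_form Z H"
proof -
  obtain F where F: "F \<subseteq> h" "lie.independent F" "h \<subseteq> lie.span F"
    using lie.maximal_independent_subset[of h] by metis
  have finF: "finite F" by (rule lie_independent_finite[OF F(2)])
  have span: "lie.span F = h"
    using F lie.span_minimal[OF F(1) subspace_h] by auto
  define T where "T Z = (\<Sum>b\<in>F. killing_form Z b *\<^sub>C b)" for Z
  have linT: "lie_linear T"
    by (rule lie_linearI) (simp_all add: T_def killing_form_add_left killing_form_scale_left
        scaleC_add_left sum.distrib lie.scale_sum_right scaleC_scaleC)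
  interpret T: module_hom scaleC scaleC T by (rule linT)
  have coeff: "c b = d b" if "(\<Sum>b\<in>F. c b *\<^sub>C b) = (\<Sum>b\<in>F. d b *\<^sub>C b)" "b \<in> F" for c d b
  proof -
    have "(\<Sum>b\<in>F. (c b - d b) *\<^sub>C b) = 0"
      using that(1) by (simp add: lie.scale_left_diff_distrib sum_subtractf)
    then have "c b - d b = 0"
      using lie.independentD[OF F(2) finF subset_refl _ that(2), of "\<lambda>b. c b - d b"] by simp
    then show ?thesis by simp
  qed
  have T0: "Z = 0" if "Z \<in> h" "T Z = 0" for Z
  proof (rule killing_form_nondegenerate_on_h[OF \<open>Z \<in> h\<close>])
    fix H assume "H \<in> h"
    have "killing_form Z b = 0" if "b \<in> F" for b
      using coeff[of "killing_form Z" "\<lambda>_. 0" b] that \<open>T Z = 0\<close> by (simp add: T_def lie.scale_zero_left)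
    then have "F \<subseteq> {H. killing_form Z H = 0}" by auto
    then have "lie.span F \<subseteq> {H. killing_form Z H = 0}"
      by (rule lie.span_minimal[OF _ subspace_killing_orthogonal])
    then show "killing_form Z H = 0" using F(3) \<open>H \<in> h\<close> by auto
  qed
  have inj: "inj_on T h"
  proof (rule inj_onI)
    fix x y assume "x \<in> h" "y \<in> h" "T x = T y"
    then have "x - y = 0" using T0[of "x - y"] lie.subspace_diff[OF subspace_h] by (simp add: T.diff)
    then show "x = y" by simp
  qed
  have "lie.independent (T ` F)"
    using T.independent_injective_image[OF F(2)] inj span by simp
  moreover have "T ` F \<subseteq> lie.span F"
    unfolding T_def by (intro image_subsetI lie.span_sum lie.span_scale lie.span_base)
  moreover have "card (T ` F) = card F"
    using inj F(1) by (meson card_image inj_on_subset)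
  ultimately have "F \<subseteq> lie.span (T ` F)"
  proof (intro subsetI)
    assume T: "lie.independent (T ` F)" "T ` F \<subseteq> lie.span F" "card (T ` F) = card F"
    fix b assume b: "b \<in> F"
    show "b \<in> lie.span (T ` F)"
    proof (rule ccontr)
      assume nb: "b \<notin> lie.span (T ` F)"
      then have "lie.independent (insert b (T ` F))" using T(1) by (rule lie.independent_insertI)
      moreover have "insert b (T ` F) \<subseteq> lie.span F" using T(2) b by (auto intro: lie.span_base)
      ultimately have "card (insert b (T ` F)) \<le> card F"
        using lie.independent_span_bound[OF finF] by blast
      moreover have "b \<notin> T ` F" using nb lie.span_base[of b "T ` F"] by blast
      ultimately show False using T(3) finF by simp
    qed
  qed
  then have "lie.span F \<subseteq> lie.span (T ` F)"
    by (rule lie.span_minimal[OF _ lie.subspace_span])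
  moreover have "(\<Sum>b\<in>F. \<xi> b *\<^sub>C b) \<in> lie.span F"
    by (intro lie.span_sum lie.span_scale lie.span_base)
  ultimately have "(\<Sum>b\<in>F. \<xi> b *\<^sub>C b) \<in> T ` lie.span F"
    unfolding T.span_image[symmetric] by blast
  then obtain Z where Z: "Z \<in> h" "(\<Sum>b\<in>F. \<xi> b *\<^sub>C b) = T Z" using span by auto
  have b: "\<xi> b = killing_form Z b" if "b \<in> F" for b
    using Z(2) that unfolding T_def by (rule coeff)
  have "lie.subspace {H \<in> h. \<xi> H = killing_form Z H}"
    using assms subspace_h lie.subspace_0[OF subspace_h]
    by (auto simp: lie.subspace_def lin_dual_def killing_form_add_right killing_form_scale_right)
      (metis lie.scale_zero_left mult_zero_left)
  then have "lie.span F \<subseteq> {H \<in> h. \<xi> H = killing_form Z H}"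
    using b F(1) by (intro lie.span_minimal) auto
  then show ?thesis using Z(1) span by auto
qed

lemma dual_vector:
  assumes "\<xi> \<in> lin_dual h"
  shows "dual_vector h \<xi> \<in> h" "H \<in> h \<Longrightarrow> killing_form (dual_vector h \<xi>) H = \<xi> H"
proof -
  have "\<exists>!Z. Z \<in> h \<and> (\<forall>H\<in>h. \<xi> H = killing_form Z H)"
  proof (rule ex_ex1I)
    show "\<exists>Z. Z \<in> h \<and> (\<forall>H\<in>h. \<xi> H = killing_form Z H)"
      using dual_vector_exists[OF assms] by blast
    fix Z Z' assume "Z \<in> h \<and> (\<forall>H\<in>h. \<xi> H = killing_form Z H)" "Z' \<in> h \<and> (\<forall>H\<in>h. \<xi> H = killing_form Z' H)"
    then have "Z - Z' = 0"
      by (intro killing_form_nondegenerate_on_h)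
        (auto simp: killing_form_diff_left lie.subspace_diff[OF subspace_h])
    then show "Z = Z'" by simp
  qed
  then have *: "dual_vector h \<xi> \<in> h \<and> (\<forall>H\<in>h. \<xi> H = killing_form (dual_vector h \<xi>) H)"
    unfolding dual_vector_def by (rule theI')
  show "dual_vector h \<xi> \<in> h" using * by blast
  show "killing_form (dual_vector h \<xi>) H = \<xi> H" if "H \<in> h" using * that by simp
qed

end


section \<open>Roots\<close>

context semisimple_cartan
begin

lemma rootsD:
  assumes "\<alpha> \<in> roots h"
  shows "\<alpha> \<in> lin_dual h" "\<alpha> \<noteq> (\<lambda>_. 0)"
  using assms by (auto simp: roots_def)

lemma obtain_root_vector:
  assumes "\<alpha> \<in> roots h"
  obtains x where "x \<in> root_space h \<alpha>" "x \<noteq> 0"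
  using assms lie.subspace_0[OF subspace_root_space, of h \<alpha>] by (auto simp: roots_def)

lemma rootsI:
  assumes "\<alpha> \<in> lin_dual h" "\<alpha> \<noteq> (\<lambda>_. 0)" "x \<in> root_space h \<alpha>" "x \<noteq> 0"
  shows "\<alpha> \<in> roots h"
  using assms by (auto simp: roots_def)

lemma obtain_opposite_root_vector:
  assumes \<alpha>: "\<alpha> \<in> lin_dual h" and x: "x \<in> root_space h \<alpha>" "x \<noteq> 0"
  obtains y where "y \<in> root_space h (\<lambda>H. - \<alpha> H)" "killing_form x y = 1"
proof -
  have "\<exists>\<xi>\<in>lin_dual h. \<exists>y\<in>root_space h \<xi>. killing_form x y \<noteq> 0"
    using killing_form_zeroI[of x] killing_form_nondegenerate[of x] x(2) by blast
  then obtain \<xi> y where y: "\<xi> \<in> lin_dual h" "y \<in> root_space h \<xi>" "killing_form x y \<noteq> 0" by blast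
  have "\<xi> = (\<lambda>H. - \<alpha> H)"
  proof (rule ccontr)
    assume "\<xi> \<noteq> (\<lambda>H. - \<alpha> H)"
    then obtain H where "H \<in> h" "\<alpha> H + \<xi> H \<noteq> 0"
      using not_opposite_imp_sum_nonzero[OF \<alpha> y(1)] by blast
    then show False using killing_form_root_spaces_orthogonal[OF x(1) y(2)] y(3) by blast
  qed
  then have "(1 / killing_form x y) *\<^sub>C y \<in> root_space h (\<lambda>H. - \<alpha> H)"
    using y(2) lie.subspace_scale[OF subspace_root_space] by blast
  then show thesis
    by (rule that) (use y(3) in \<open>simp add: killing_form_scale_right\<close>)
qed

lemma bracket_opposite_root_vectors:
  assumes \<alpha>: "\<alpha> \<in> lin_dual h" and x: "x \<in> root_space h \<alpha>" and y: "y \<in> root_space h (\<lambda>H. - \<alpha> H)"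
  shows "lie_bracket x y = killing_form x y *\<^sub>C dual_vector h \<alpha>"
proof -
  let ?Z = "lie_bracket x y - killing_form x y *\<^sub>C dual_vector h \<alpha>"
  have "?Z \<in> h"
    using root_space_bracket_opposite[OF x y] dual_vector(1)[OF \<alpha>] subspace_h
    by (intro lie.subspace_diff lie.subspace_scale)
  moreover have "killing_form ?Z H = 0" if H: "H \<in> h" for H
  proof -
    have "lie_bracket y H = \<alpha> H *\<^sub>C y"
      using y H lie_bracket_anticomm[of y H] by (simp add: root_space_def)
    then show ?thesis
      using dual_vector(2)[OF \<alpha> H]
      by (simp add: killing_form_diff_left killing_form_scale_left killing_form_scale_right
          killing_form_invariant)
  qed
  ultimately have "?Z = 0" by (rule killing_form_nondegenerate_on_h)
  then show ?thesis by simp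
qed

lemma roots_uminus:
  assumes "\<alpha> \<in> roots h"
  shows "(\<lambda>H. - \<alpha> H) \<in> roots h"
proof -
  obtain x where x: "x \<in> root_space h \<alpha>" "x \<noteq> 0" by (rule obtain_root_vector[OF assms])
  obtain y where y: "y \<in> root_space h (\<lambda>H. - \<alpha> H)" "killing_form x y = 1"
    by (rule obtain_opposite_root_vector[OF rootsD(1)[OF assms] x])
  show ?thesis
  proof (rule rootsI[OF lin_dual_uminus[OF rootsD(1)[OF assms]] _ y(1)])
    show "(\<lambda>H. - \<alpha> H) \<noteq> (\<lambda>_. 0)" using rootsD(2)[OF assms] by (auto simp: fun_eq_iff)
    show "y \<noteq> 0" using y(2) by auto
  qed
qed

lemma dual_vector_eq_bracket:
  assumes "\<alpha> \<in> roots h"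
  obtains x y where "x \<in> root_space h \<alpha>" "y \<in> root_space h (\<lambda>H. - \<alpha> H)" "lie_bracket x y = dual_vector h \<alpha>"
proof -
  obtain x where x: "x \<in> root_space h \<alpha>" "x \<noteq> 0" by (rule obtain_root_vector[OF assms])
  obtain y where y: "y \<in> root_space h (\<lambda>H. - \<alpha> H)" "killing_form x y = 1"
    by (rule obtain_opposite_root_vector[OF rootsD(1)[OF assms] x])
  show thesis
    using that[OF x(1) y(1)] bracket_opposite_root_vectors[OF rootsD(1)[OF assms] x(1) y(1)] y(2)
    by (simp add: scaleC_one)
qed

text \<open>For \<open>t = H\<^sub>\<alpha>\<close> the identity \<open>K t t = R (\<alpha> t)\<^sup>2\<close> reads \<open>\<alpha> t = R (\<alpha> t)\<^sup>2\<close>, as \<open>K t t = \<alpha> t\<close>.\<close>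
lemma root_length_positive:
  assumes "\<alpha> \<in> roots h"
  obtains a :: real where "a > 0" "\<alpha> (dual_vector h \<alpha>) = of_real a"
proof -
  let ?t = "dual_vector h \<alpha>"
  obtain x y where xy: "x \<in> root_space h \<alpha>" "y \<in> root_space h (\<lambda>H. - \<alpha> H)" "lie_bracket x y = ?t"
    using dual_vector_eq_bracket[OF assms] by blast
  obtain H where H: "H \<in> h" "\<alpha> H \<noteq> 0"
    using nonzero_weight[OF rootsD[OF assms]] by blast
  have "?t \<noteq> 0" using dual_vector(2)[OF rootsD(1)[OF assms] H(1)] H(2) by auto
  then obtain R :: real where R: "R > 0" "\<alpha> ?t \<noteq> 0" "killing_form ?t ?t = of_real R * (\<alpha> ?t)\<^sup>2"
    using killing_form_bracket_opposite[OF xy(1,2) H] xy(3) by metis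
  have "killing_form ?t ?t = \<alpha> ?t"
    by (intro dual_vector rootsD assms)
  then have "\<alpha> ?t = of_real (1 / R)"
    using R by (simp add: power2_eq_square field_simps)
  then show thesis using that[of "1 / R"] R(1) by simp
qed

lemma root_real_on_dual_vectors:
  assumes "\<alpha> \<in> roots h" "\<beta> \<in> roots h"
  shows "Im (\<beta> (dual_vector h \<alpha>)) = 0"
proof -
  obtain x y where xy: "x \<in> root_space h \<alpha>" "y \<in> root_space h (\<lambda>H. - \<alpha> H)" "lie_bracket x y = dual_vector h \<alpha>"
    using dual_vector_eq_bracket[OF assms(1)] by blast
  obtain H where H: "H \<in> h" "\<alpha> H \<noteq> 0"
    using nonzero_weight[OF rootsD[OF assms(1)]] by blast
  obtain z where z: "z \<in> root_space h \<beta>" "z \<noteq> 0" by (rule obtain_root_vector[OF assms(2)])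
  obtain a where a: "\<alpha> (dual_vector h \<alpha>) = of_real a" using root_length_positive[OF assms(1)] by blast
  obtain r :: real where "\<beta> (dual_vector h \<alpha>) = of_real r * \<alpha> (dual_vector h \<alpha>)"
    using root_string_proportional[OF xy(1,2) H z] xy(3) by auto
  then show ?thesis by (simp add: a)
qed

lemma root_real_on_real_cartan:
  assumes "\<beta> \<in> roots h" "R \<in> real_cartan h"
  shows "Im (\<beta> R) = 0"
proof -
  obtain c where R: "R = (\<Sum>\<alpha>\<in>roots h. complex_of_real (c \<alpha>) *\<^sub>C dual_vector h \<alpha>)"
    using assms(2) by (auto simp: real_cartan_def)
  have "(\<Sum>\<alpha>\<in>A. complex_of_real (c \<alpha>) *\<^sub>C dual_vector h \<alpha>) \<in> h
      \<and> Im (\<beta> (\<Sum>\<alpha>\<in>A. complex_of_real (c \<alpha>) *\<^sub>C dual_vector h \<alpha>)) = 0" if "A \<subseteq> roots h" for A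
    using that
  proof (induction A rule: infinite_finite_induct)
    case (insert \<alpha> A)
    let ?s = "\<Sum>\<alpha>\<in>A. complex_of_real (c \<alpha>) *\<^sub>C dual_vector h \<alpha>"
    have "dual_vector h \<alpha> \<in> h"
      using insert.prems dual_vector(1) rootsD(1) by simp
    then have \<alpha>: "dual_vector h \<alpha> \<in> h" "complex_of_real (c \<alpha>) *\<^sub>C dual_vector h \<alpha> \<in> h"
      using lie.subspace_scale[OF subspace_h] by blast+
    then have "\<beta> (complex_of_real (c \<alpha>) *\<^sub>C dual_vector h \<alpha> + ?s) = of_real (c \<alpha>) * \<beta> (dual_vector h \<alpha>) + \<beta> ?s"
      using insert rootsD(1)[OF assms(1)] by (simp add: lin_dual_def)
    then show ?case
      using insert \<alpha> lie.subspace_add[OF subspace_h] root_real_on_dual_vectors[OF _ assms(1)] by simp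
  next
    have "\<beta> 0 = 0"
      using rootsD(1)[OF assms(1)] lie.subspace_0[OF subspace_h] unfolding lin_dual_def
      by (metis (mono_tags, lifting) lie.scale_zero_left mem_Collect_eq mult_zero_left)
    { case (infinite A) then show ?case using \<open>\<beta> 0 = 0\<close> lie.subspace_0[OF subspace_h] by simp }
    { case empty then show ?case using \<open>\<beta> 0 = 0\<close> lie.subspace_0[OF subspace_h] by simp }
  qed
  then show ?thesis using R by simp
qed

text \<open>A root takes a real nonzero value at the regular point \<open>R\<close> of the chamber, and its sign there is its
  sign on the whole chamber.\<close>
lemma positive_or_negative_root:
  assumes C: "weyl_chamber h C" and \<alpha>: "\<alpha> \<in> roots h"
  shows "\<alpha> \<in> positive_roots h C \<or> (\<lambda>H. - \<alpha> H) \<in> positive_roots h C"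
proof -
  obtain R where R: "R \<in> real_cartan h" "\<forall>\<alpha>\<in>roots h. \<alpha> R \<noteq> 0"
    "C = {H \<in> real_cartan h. \<forall>\<alpha>\<in>roots h. sgn (Re (\<alpha> H)) = sgn (Re (\<alpha> R))}"
    using C by (auto simp: weyl_chamber_def)
  have pos: "\<beta> \<in> positive_roots h C" if "\<beta> \<in> roots h" "Re (\<beta> R) > 0" for \<beta>
  proof -
    have "Re (\<beta> H) > 0" if "H \<in> C" for H
    proof -
      have "sgn (Re (\<beta> H)) = sgn (Re (\<beta> R))" using \<open>H \<in> C\<close> \<open>\<beta> \<in> roots h\<close> R(3) by blast
      then show ?thesis using \<open>Re (\<beta> R) > 0\<close> by (simp add: sgn_1_pos)
    qed
    then show ?thesis using that(1) by (simp add: positive_roots_def)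
  qed
  have "Re (\<alpha> R) \<noteq> 0"
    using R(2) \<alpha> root_real_on_real_cartan[OF \<alpha> R(1)] by (metis complex_eq_iff zero_complex.simps)
  then consider "Re (\<alpha> R) > 0" | "Re (- \<alpha> R) > 0" by (simp add: neq_iff) blast
  then show ?thesis using pos[OF \<alpha>] pos[OF roots_uminus[OF \<alpha>]] by cases auto
qed

end


section \<open>The highest weight line\<close>

text \<open>The linear form \<open>\<epsilon>\<^sub>0\<close> of weight \<open>\<mu>\<close> is the coordinate belonging to \<open>v\<^sub>0\<close> in a basis of weight
  vectors.\<close>
locale highest_weight_rep = semisimple_cartan h for h :: "'g::complex_lie_algebra set" +
  fixes C :: "'g set" and \<rho> :: "'g \<Rightarrow> complex^'n^'n" and \<mu> :: "'g \<Rightarrow> complex"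
    and v\<^sub>0 :: "complex^'n" and \<epsilon>\<^sub>0 :: "complex^'n \<Rightarrow> complex"
  assumes chamber: "weyl_chamber h C" and irr: "irreducible_rep \<rho>"
    and hw: "highest_weight_vector h C \<rho> \<mu> v\<^sub>0"
    and lin_\<epsilon>: "linear_form \<epsilon>\<^sub>0" and \<epsilon>_v: "\<epsilon>\<^sub>0 v\<^sub>0 = 1"
    and \<epsilon>_weight: "\<And>H w. H \<in> h \<Longrightarrow> \<epsilon>\<^sub>0 (\<rho> H *v w) = \<mu> H * \<epsilon>\<^sub>0 w"
begin

abbreviation H\<mu> :: 'g where "H\<mu> \<equiv> dual_vector h \<mu>"

lemma rep: "\<rho> (X + Y) = \<rho> X + \<rho> Y" "\<rho> (c *\<^sub>C X) *v w = c *s (\<rho> X *v w)"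
  "\<rho> (lie_bracket X Y) = \<rho> X ** \<rho> Y - \<rho> Y ** \<rho> X"
  using irr unfolding irreducible_rep_def lie_representation_def by blast+

lemma rep_commute: "\<rho> X *v (\<rho> Y *v w) = \<rho> Y *v (\<rho> X *v w) + \<rho> (lie_bracket X Y) *v w"
  by (simp add: rep matrix_vector_mult_diff_rdistrib matrix_vector_mul_assoc)

lemma rep_zero: "\<rho> 0 *v w = 0"
  using rep(2)[of 0 0 w] by simp

lemma \<mu>: "\<mu> \<in> lin_dual h" and v_nonzero: "v\<^sub>0 \<noteq> 0" and v_weight: "H \<in> h \<Longrightarrow> \<rho> H *v v\<^sub>0 = \<mu> H *s v\<^sub>0"
  and v_highest: "\<alpha> \<in> positive_roots h C \<Longrightarrow> X \<in> root_space h \<alpha> \<Longrightarrow> \<rho> X *v v\<^sub>0 = 0"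
  using hw unfolding highest_weight_vector_def weight_space_def by blast+

lemma H\<mu>: "H\<mu> \<in> h" "H \<in> h \<Longrightarrow> killing_form H\<mu> H = \<mu> H"
  by (intro dual_vector \<mu>; assumption)+

lemma subspace_rep_preimage: "vec.subspace W \<Longrightarrow> lie.subspace {X. \<rho> X *v w \<in> W}"
  by (auto simp: lie.subspace_def rep rep_zero matrix_vector_mult_add_rdistrib
      vec.subspace_add vec.subspace_scale vec.subspace_0)

lemma rep_in_subspaceI:
  assumes "vec.subspace W" "\<And>\<alpha> X. \<alpha> \<in> lin_dual h \<Longrightarrow> X \<in> root_space h \<alpha> \<Longrightarrow> \<rho> X *v w \<in> W"
  shows "\<rho> X *v w \<in> W"
proof -
  have "X \<in> lie.span (\<Union>\<xi>\<in>lin_dual h. root_space h \<xi>)" using span_root_spaces by simp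
  then show ?thesis
    by (rule lie.span_induct) (use assms in \<open>auto intro: subspace_rep_preimage\<close>)
qed

lemma rep_shifts_eigenvalue:
  assumes "X \<in> root_space h \<alpha>" "H \<in> h" "\<rho> H *v w = e *s w"
  shows "\<rho> H *v (\<rho> X *v w) = (e + \<alpha> H) *s (\<rho> X *v w)"
  using assms rep_commute[of H X w]
  by (simp add: root_space_def rep vec.scale vec.scale_left_distrib)

text \<open>For a negative root \<open>\<alpha>\<close> the \<open>sl\<^sub>2\<close>-triple of \<open>- \<alpha>\<close> shows that \<open>- \<alpha> (H\<mu>)\<close> is \<open>k / 2\<close> times the squared length
  of \<open>\<alpha>\<close>, where \<open>k\<close> is the number of nonzero steps in the ladder \<open>X\<^sup>k v\<^sub>0\<close>.\<close>
lemma negative_root_pairing: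
  assumes \<alpha>: "\<alpha> \<in> roots h" and neg: "(\<lambda>H. - \<alpha> H) \<in> positive_roots h C"
    and X: "X \<in> root_space h \<alpha>" "X \<noteq> 0"
  obtains r :: real where "r \<ge> 0" "\<alpha> H\<mu> = - of_real r" "r = 0 \<Longrightarrow> \<rho> X *v v\<^sub>0 = 0"
proof -
  let ?\<beta> = "\<lambda>H. - \<alpha> H"
  define t where "t = dual_vector h ?\<beta>"
  have \<beta>: "?\<beta> \<in> roots h" by (rule roots_uminus[OF \<alpha>])
  have t: "t \<in> h" "\<And>H. H \<in> h \<Longrightarrow> killing_form t H = - \<alpha> H"
    unfolding t_def using dual_vector[OF rootsD(1)[OF \<beta>]] by auto
  obtain a where a: "a > 0" "- \<alpha> t = of_real a"
    unfolding t_def using root_length_positive[OF \<beta>] by blast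
  obtain e where e: "e \<in> root_space h ?\<beta>" "killing_form X e = 1"
    by (rule obtain_opposite_root_vector[OF rootsD(1)[OF \<alpha>] X])
  have br: "lie_bracket e X = t"
    using bracket_opposite_root_vectors[OF rootsD(1)[OF \<beta>] e(1), of X] X(1) e(2)
    by (simp add: killing_form_commute[of e X] scaleC_one t_def)
  have tX: "lie_bracket t X = - (of_real a *\<^sub>C X)"
  proof -
    have "\<alpha> t = - of_real a" using a(2) by (simp add: minus_equation_iff[of "\<alpha> t"])
    moreover have "lie_bracket t X = \<alpha> t *\<^sub>C X" using X(1) t(1) by (simp add: root_space_def)
    ultimately show ?thesis by (simp only: lie.scale_minus_left)
  qed
  have \<rho>tX: "\<rho> t *v (\<rho> X *v w) = \<rho> X *v (\<rho> t *v w) + (- of_real a) *s (\<rho> X *v w)" for w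
    using rep_commute[of t X w] rep(2)[of "- of_real a" X w] tX by simp
  have nil: "\<exists>k. (((*v) (\<rho> X)) ^^ k) v\<^sub>0 = 0"
  proof (rule vec.ladder_terminates[where D = "(*v) (\<rho> t)" and y = "(*v) (\<rho> X)" and a = "- of_real a"])
    show "\<rho> t *v (\<rho> X *v w) = \<rho> X *v (\<rho> t *v w) + (- of_real a) *s (\<rho> X *v w)" for w
      by (rule \<rho>tX)
    show "\<rho> t *v v\<^sub>0 = \<mu> t *s v\<^sub>0" by (rule v_weight[OF t(1)])
    show "module_hom (*s) (*s) ((*v) (\<rho> t))"
      using matrix_vector_mul_linear_gen[of "\<rho> t"] by (simp add: linear_iff_module_hom)
    show "finite (cart_basis :: (complex^'n) set)" "vec.span (cart_basis :: (complex^'n) set) = UNIV"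
      by (auto simp: finite_cart_basis vec.span_Basis)
  qed (use a in \<open>auto simp: inj_def vec.scale\<close>)
  obtain k where k: "(((*v) (\<rho> X)) ^^ k) v\<^sub>0 \<noteq> 0" "(((*v) (\<rho> X)) ^^ Suc k) v\<^sub>0 = 0"
    "(\<Sum>j\<le>k. \<mu> t - of_nat j * of_real a) = 0"
  proof (rule vec.highest_weight_of_finite_ladder[of "(*v) (\<rho> e)" "(*v) (\<rho> X)" "(*v) (\<rho> t)" "of_real a" "v\<^sub>0" "\<mu> t"])
    show "\<rho> e *v (\<rho> X *v w) = \<rho> X *v (\<rho> e *v w) + \<rho> t *v w" for w
      using rep_commute[of e X w] br by simp
    show "\<rho> t *v (\<rho> X *v w) = \<rho> X *v (\<rho> t *v w) - of_real a *s (\<rho> X *v w)" for w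
      using \<rho>tX[of w] by simp
    show "\<rho> e *v v\<^sub>0 = 0" using v_highest[OF neg e(1)] .
    show "\<rho> t *v v\<^sub>0 = \<mu> t *s v\<^sub>0" using v_weight[OF t(1)] .
  qed (use v_nonzero nil in \<open>auto simp: vec.scale\<close>)
  have "\<mu> t = of_real (real k / 2) * of_real a"
    using k(3) by (rule sum_arithmetic_progression_eq_0)
  moreover have "\<mu> t = - \<alpha> H\<mu>"
    using H\<mu>(2)[OF t(1)] t(2)[OF H\<mu>(1)] by (simp add: killing_form_commute)
  ultimately have "- \<alpha> H\<mu> = of_real (real k / 2 * a)" by simp
  then have "\<alpha> H\<mu> = - of_real (real k / 2 * a)" by (metis minus_minus)
  moreover have "\<rho> X *v v\<^sub>0 = 0" if "real k / 2 * a = 0"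
    using that a k(2) by simp
  ultimately show thesis using that[of "real k / 2 * a"] a(1) by simp
qed

definition lowering :: "'g set" where
  "lowering = {X. \<exists>\<alpha> r. \<alpha> \<in> lin_dual h \<and> X \<in> root_space h \<alpha> \<and> 0 < r \<and> \<alpha> H\<mu> = - complex_of_real r}"

text \<open>A root vector outside \<open>lowering\<close> belongs to a positive root and kills \<open>v\<^sub>0\<close>, or to a negative root
  orthogonal to \<open>\<mu>\<close>, whose ladder from \<open>v\<^sub>0\<close> has no step; elements of \<open>h\<close> act on \<open>v\<^sub>0\<close> by scalars.\<close>
lemma root_vector_dichotomy:
  assumes "\<alpha> \<in> lin_dual h" "X \<in> root_space h \<alpha>"
  shows "X \<in> lowering \<or> (\<exists>c. \<rho> X *v v\<^sub>0 = c *s v\<^sub>0)"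
proof -
  consider "X = 0" | "\<alpha> = (\<lambda>_. 0)" | "X \<noteq> 0" "\<alpha> \<noteq> (\<lambda>_. 0)" by blast
  then show ?thesis
  proof cases
    case 1
    then show ?thesis using rep_zero[of v\<^sub>0] by (auto intro: exI[of _ 0])
  next
    case 2
    then show ?thesis using assms root_space_0 v_weight by auto
  next
    case 3
    then have \<alpha>: "\<alpha> \<in> roots h" using rootsI assms by blast
    show ?thesis
    proof (cases "\<alpha> \<in> positive_roots h C")
      case True
      then show ?thesis using v_highest assms(2) by (auto intro: exI[of _ 0])
    next
      case False
      then have "(\<lambda>H. - \<alpha> H) \<in> positive_roots h C"
        using positive_or_negative_root[OF chamber \<alpha>] by blast
      then obtain r :: real where r: "r \<ge> 0" "\<alpha> H\<mu> = - of_real r" "r = 0 \<Longrightarrow> \<rho> X *v v\<^sub>0 = 0"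
        using negative_root_pairing[OF \<alpha> _ assms(2) 3(1)] by blast
      show ?thesis
      proof (cases "r = 0")
        case True
        then show ?thesis using r(3) by (auto intro: exI[of _ 0])
      next
        case False
        then show ?thesis using r assms unfolding lowering_def by force
      qed
    qed
  qed
qed

text \<open>The smallest subspace \<open>W\<close> that contains \<open>v\<^sub>0\<close> and is stable under lowering is invariant under the whole
  algebra, because the vectors of \<open>W\<close> that the algebra maps into \<open>W\<close> contain \<open>v\<^sub>0\<close> and are
  again stable under lowering.  By irreducibility \<open>W\<close> is everything.\<close>
lemma lowering_stable_subspace_UNIV:
  assumes U: "vec.subspace U" "v\<^sub>0 \<in> U" "\<And>X u. X \<in> lowering \<Longrightarrow> u \<in> U \<Longrightarrow> \<rho> X *v u \<in> U"
  shows "U = UNIV"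
proof -
  define stable where "stable U \<longleftrightarrow> vec.subspace U \<and> v\<^sub>0 \<in> U \<and> (\<forall>X\<in>lowering. \<forall>u\<in>U. \<rho> X *v u \<in> U)" for U
  define W where "W = \<Inter>{U. stable U}"
  have W: "vec.subspace W" "v\<^sub>0 \<in> W" "\<And>X u. X \<in> lowering \<Longrightarrow> u \<in> W \<Longrightarrow> \<rho> X *v u \<in> W"
    unfolding W_def stable_def by (auto intro!: vec.subspace_Inter)
  let ?W' = "{w \<in> W. \<forall>X. \<rho> X *v w \<in> W}"
  have "stable ?W'"
    unfolding stable_def
  proof (intro conjI ballI)
    show "vec.subspace ?W'"
      using W(1) by (auto simp: vec.subspace_def vec.add vec.scale vec.zero)
    have "\<rho> X *v v\<^sub>0 \<in> W" for X
    proof (rule rep_in_subspaceI[OF W(1)])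
      fix \<alpha> Y assume "\<alpha> \<in> lin_dual h" "Y \<in> root_space h \<alpha>"
      then show "\<rho> Y *v v\<^sub>0 \<in> W"
        using root_vector_dichotomy[of \<alpha> Y] W vec.subspace_scale[OF W(1,2)] by auto
    qed
    then show "v\<^sub>0 \<in> ?W'" using W(2) by simp
    fix Y w assume Y: "Y \<in> lowering" and w: "w \<in> ?W'"
    have "\<rho> X *v (\<rho> Y *v w) \<in> W" for X
      using rep_commute[of X Y w] W(3)[OF Y] w by (simp add: vec.subspace_add[OF W(1)])
    then show "\<rho> Y *v w \<in> ?W'" using W(3)[OF Y] w by simp
  qed
  then have "W \<subseteq> ?W'" unfolding W_def by blast
  then have "\<forall>X. \<forall>w\<in>W. \<rho> X *v w \<in> W" by blast
  then have "W = {0} \<or> W = UNIV"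
    using irr W(1) unfolding irreducible_rep_def by blast
  then have "W = UNIV" using W(2) v_nonzero by auto
  moreover have "W \<subseteq> U" unfolding W_def stable_def using U by blast
  ultimately show ?thesis by auto
qed

definition lower_eigenvectors :: "(complex^'n) set" where
  "lower_eigenvectors = {w. \<exists>e\<in>{\<mu> H\<mu> - of_real r | r. r > 0}. \<rho> H\<mu> *v w = e *s w}"

lemma lower_eigenvectorsI:
  "0 < r \<Longrightarrow> \<rho> H\<mu> *v w = (\<mu> H\<mu> - of_real r) *s w \<Longrightarrow> w \<in> lower_eigenvectors"
  unfolding lower_eigenvectors_def by blast

lemma lower_eigenvectorsE:
  assumes "w \<in> lower_eigenvectors"
  obtains r where "0 < r" "\<rho> H\<mu> *v w = (\<mu> H\<mu> - of_real r) *s w"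
  using assms unfolding lower_eigenvectors_def by blast

lemma span_v_lower_eigenvectors: "vec.span (insert v\<^sub>0 lower_eigenvectors) = UNIV"
proof (rule lowering_stable_subspace_UNIV)
  fix X u assume X: "X \<in> lowering" and "u \<in> vec.span (insert v\<^sub>0 lower_eigenvectors)"
  obtain \<alpha> r where \<alpha>: "X \<in> root_space h \<alpha>" "r > 0" "\<alpha> H\<mu> = - complex_of_real r"
    using X by (auto simp: lowering_def)
  note shift = rep_shifts_eigenvalue[OF \<alpha>(1) H\<mu>(1), unfolded \<alpha>(3)]
  show "\<rho> X *v u \<in> vec.span (insert v\<^sub>0 lower_eigenvectors)"
    using \<open>u \<in> vec.span (insert v\<^sub>0 lower_eigenvectors)\<close>
  proof (rule vec.span_induct)
    show "vec.subspace {u. \<rho> X *v u \<in> vec.span (insert v\<^sub>0 lower_eigenvectors)}"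
      by (auto simp: vec.subspace_def vec.add vec.scale vec.zero vec.span_add vec.span_scale vec.span_zero)
    fix w assume "w \<in> insert v\<^sub>0 lower_eigenvectors"
    then have "\<exists>s::real. s \<ge> 0 \<and> \<rho> H\<mu> *v w = (\<mu> H\<mu> - of_real s) *s w"
    proof
      assume "w = v\<^sub>0"
      then show ?thesis using v_weight[OF H\<mu>(1)] by (intro exI[of _ 0]) simp
    next
      assume "w \<in> lower_eigenvectors"
      then show ?thesis by (rule lower_eigenvectorsE) (blast intro: less_imp_le)
    qed
    then obtain s :: real where s: "s \<ge> 0" "\<rho> H\<mu> *v w = (\<mu> H\<mu> - of_real s) *s w" by blast
    have "\<rho> H\<mu> *v (\<rho> X *v w) = (\<mu> H\<mu> - of_real (s + r)) *s (\<rho> X *v w)"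
      using shift[OF s(2)] by (simp add: algebra_simps)
    then have "\<rho> X *v w \<in> lower_eigenvectors"
      by (rule lower_eigenvectorsI[rotated]) (use s(1) \<alpha>(2) in simp)
    then show "\<rho> X *v w \<in> vec.span (insert v\<^sub>0 lower_eigenvectors)"
      by (intro vec.span_base) simp
  qed
qed (auto intro: vec.span_base)

lemma \<epsilon>_linear: "\<epsilon>\<^sub>0 (x + y) = \<epsilon>\<^sub>0 x + \<epsilon>\<^sub>0 y" "\<epsilon>\<^sub>0 (c *s x) = c * \<epsilon>\<^sub>0 x" "\<epsilon>\<^sub>0 0 = 0"
  using Vector_Spaces.linear.axioms(3)[OF lin_\<epsilon>] module_hom.add module_hom.scale module_hom.zero by blast+

lemma \<epsilon>_lower: "w \<in> lower_eigenvectors \<Longrightarrow> \<epsilon>\<^sub>0 w = 0"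
  using \<epsilon>_weight[OF H\<mu>(1), of w] by (auto simp: lower_eigenvectors_def \<epsilon>_linear algebra_simps)

text \<open>Modulo the line of \<open>v\<^sub>0\<close> every vector is a sum of eigenvectors for eigenvalues \<open>\<mu> H\<mu> - r\<close>
  with \<open>r > 0\<close>, and these are independent of eigenvectors for \<open>\<mu> H\<mu>\<close>.\<close>
lemma top_eigenspace_line:
  assumes w: "\<rho> H\<mu> *v w = \<mu> H\<mu> *s w"
  obtains a where "w = a *s v\<^sub>0"
proof -
  have D: "module_hom (*s) (*s) ((*v) (\<rho> H\<mu>))"
    using matrix_vector_mul_linear_gen[of "\<rho> H\<mu>"] by (simp add: linear_iff_module_hom)
  obtain a where a: "w - a *s v\<^sub>0 \<in> vec.span lower_eigenvectors"
    using span_v_lower_eigenvectors vec.span_breakdown_eq[of w v\<^sub>0] by auto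
  obtain I y where I: "finite I" "I \<subseteq> {\<mu> H\<mu> - of_real r | r. r > 0}"
    "\<And>c. c \<in> I \<Longrightarrow> \<rho> H\<mu> *v y c = c *s y c" "w - a *s v\<^sub>0 = (\<Sum>c\<in>I. y c)"
    using vec.span_eigenvectors_decomposition[OF D a[unfolded lower_eigenvectors_def]] by blast
  define y' where "y' c = (if c = \<mu> H\<mu> then w - a *s v\<^sub>0 else - y c)" for c
  have nI: "\<mu> H\<mu> \<notin> I" using I(2) by auto
  have "(\<Sum>c\<in>I. y' c) = (\<Sum>c\<in>I. - y c)"
    using nI by (intro sum.cong) (auto simp: y'_def)
  then have sum0: "(\<Sum>c\<in>insert (\<mu> H\<mu>) I. y' c) \<in> {0}"
    using I(1,4) nI by (simp add: sum_negf) (simp add: y'_def)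
  have ev: "\<rho> H\<mu> *v y' c = c *s y' c" if "c \<in> insert (\<mu> H\<mu>) I" for c
    using that I(3) w v_weight[OF H\<mu>(1)]
    by (auto simp: y'_def vec.diff vec.scale vec.neg vec.scale_right_diff_distrib mult.commute)
  have "y' (\<mu> H\<mu>) \<in> {0}"
    by (rule vec.eigencomponents_in_invariant_subspace[OF D _ _ _ _ ev sum0])
      (use I(1) in \<open>auto simp: vec.subspace_single_0 vec.zero\<close>)
  then show thesis using that[of a] by (simp add: y'_def)
qed

text \<open>An operator that commutes with \<open>\<rho> H\<mu>\<close> preserves both the line of \<open>v\<^sub>0\<close>, which is its top eigenspace, and the
  sum of the lower eigenspaces, on which \<open>\<epsilon>\<^sub>0\<close> vanishes.\<close>
lemma commuting_operator_eigenvector: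
  assumes g: "g ** \<rho> H\<mu> = \<rho> H\<mu> ** g"
  obtains a where "g *v v\<^sub>0 = a *s v\<^sub>0" "\<And>w. \<epsilon>\<^sub>0 (g *v w) = a * \<epsilon>\<^sub>0 w"
proof -
  have comm: "\<rho> H\<mu> *v (g *v w) = g *v (\<rho> H\<mu> *v w)" for w
    using g by (simp add: matrix_vector_mul_assoc)
  obtain a where a: "g *v v\<^sub>0 = a *s v\<^sub>0"
    using top_eigenspace_line[of "g *v v\<^sub>0"] by (auto simp: comm v_weight[OF H\<mu>(1)] vec.scale)
  have "\<epsilon>\<^sub>0 (g *v w) = a * \<epsilon>\<^sub>0 w" for w
  proof -
    have "w \<in> vec.span (insert v\<^sub>0 lower_eigenvectors)" using span_v_lower_eigenvectors by simp
    then show ?thesis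
    proof (rule vec.span_induct)
      show "vec.subspace {w. \<epsilon>\<^sub>0 (g *v w) = a * \<epsilon>\<^sub>0 w}"
        by (auto simp: vec.subspace_def vec.add vec.scale vec.zero \<epsilon>_linear algebra_simps)
      fix w assume "w \<in> insert v\<^sub>0 lower_eigenvectors"
      then consider "w = v\<^sub>0" | "w \<in> lower_eigenvectors" by blast
      then show "\<epsilon>\<^sub>0 (g *v w) = a * \<epsilon>\<^sub>0 w"
      proof cases
        case 2
        then obtain r where r: "0 < r" "\<rho> H\<mu> *v w = (\<mu> H\<mu> - of_real r) *s w"
          by (rule lower_eigenvectorsE)
        then have "g *v w \<in> lower_eigenvectors"
          by (intro lower_eigenvectorsI[OF r(1)]) (simp only: comm vec.scale)
        then show ?thesis using 2 \<epsilon>_lower by simp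
      qed (simp add: a \<epsilon>_v \<epsilon>_linear)
    qed
  qed
  then show thesis using that a by blast
qed

text \<open>Both sides are linear in \<open>X\<close>, agree with \<open>\<mu>\<close> on \<open>h\<close> and vanish on root vectors.\<close>
lemma killing_form_H\<mu>: "killing_form H\<mu> X = \<epsilon>\<^sub>0 (\<rho> X *v v\<^sub>0)"
proof -
  have "X \<in> lie.span (\<Union>\<xi>\<in>lin_dual h. root_space h \<xi>)" using span_root_spaces by simp
  then show ?thesis
  proof (rule lie.span_induct)
    show "lie.subspace {X. killing_form H\<mu> X = \<epsilon>\<^sub>0 (\<rho> X *v v\<^sub>0)}"
      by (auto simp: lie.subspace_def killing_form_add_right killing_form_scale_right rep rep_zero
          matrix_vector_mult_add_rdistrib \<epsilon>_linear)
    fix X assume "X \<in> (\<Union>\<xi>\<in>lin_dual h. root_space h \<xi>)"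
    then obtain \<alpha> where \<alpha>: "\<alpha> \<in> lin_dual h" "X \<in> root_space h \<alpha>" by blast
    show "killing_form H\<mu> X = \<epsilon>\<^sub>0 (\<rho> X *v v\<^sub>0)"
    proof (cases "\<alpha> = (\<lambda>_. 0)")
      case True
      then have "X \<in> h" using \<alpha> root_space_0 by simp
      then show ?thesis by (simp add: H\<mu> v_weight \<epsilon>_linear \<epsilon>_v)
    next
      case False
      then obtain H where H: "H \<in> h" "\<alpha> H \<noteq> 0" using nonzero_weight[OF \<alpha>(1)] by blast
      have "(\<mu> H + \<alpha> H) * \<epsilon>\<^sub>0 (\<rho> X *v v\<^sub>0) = \<mu> H * \<epsilon>\<^sub>0 (\<rho> X *v v\<^sub>0)"
        using \<epsilon>_weight[OF H(1), of "\<rho> X *v v\<^sub>0"]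
        by (simp only: \<epsilon>_linear rep_shifts_eigenvalue[OF \<alpha>(2) H(1) v_weight[OF H(1)]])
      then have "\<epsilon>\<^sub>0 (\<rho> X *v v\<^sub>0) = 0" using H(2) by (simp add: algebra_simps)
      then show ?thesis using killing_form_h_root_space[OF H\<mu>(1) \<alpha>(1) False \<alpha>(2)] by simp
    qed
  qed
qed

end


section \<open>Linear groups acting on tensors\<close>

lemma matrix_inv_inverse:
  fixes g :: "complex^'n^'n"
  assumes "invertible g"
  shows "g ** matrix_inv g = mat 1" "matrix_inv g ** g = mat 1"
  using someI_ex[OF assms[unfolded invertible_def]] by (simp_all add: matrix_inv_def)

lemma invertible_matrix_inv: "invertible (g :: complex^'n^'n) \<Longrightarrow> invertible (matrix_inv g)"
  using matrix_inv_inverse invertible_def by blast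

lemma matrix_inv_eqI:
  fixes g k :: "complex^'n^'n"
  assumes "g ** k = mat 1" "k ** g = mat 1"
  shows "matrix_inv g = k"
proof -
  have "invertible g" using assms invertible_def by blast
  then have "matrix_inv g ** (g ** k) = k"
    by (simp add: matrix_mul_assoc matrix_inv_inverse)
  then show ?thesis by (simp add: assms(1))
qed

lemma matrix_inv_involutive: "invertible (g :: complex^'n^'n) \<Longrightarrow> matrix_inv (matrix_inv g) = g"
  by (intro matrix_inv_eqI matrix_inv_inverse)

lemma matrix_inv_mult:
  fixes g k :: "complex^'n^'n"
  assumes "invertible g" "invertible k"
  shows "matrix_inv (g ** k) = matrix_inv k ** matrix_inv g"
proof (rule matrix_inv_eqI)
  have "g ** k ** (matrix_inv k ** matrix_inv g) = g ** (k ** matrix_inv k) ** matrix_inv g"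
    by (simp only: matrix_mul_assoc)
  then show "g ** k ** (matrix_inv k ** matrix_inv g) = mat 1"
    by (simp add: matrix_inv_inverse assms)
  have "matrix_inv k ** matrix_inv g ** (g ** k) = matrix_inv k ** (matrix_inv g ** g) ** k"
    by (simp only: matrix_mul_assoc)
  then show "matrix_inv k ** matrix_inv g ** (g ** k) = mat 1"
    by (simp add: matrix_inv_inverse assms)
qed

lemma matrix_mult_linear:
  fixes A A' :: "complex^'n^'m" and B B' :: "complex^'p^'n"
  shows "(A + A') ** B = A ** B + A' ** B" "A ** (B + B') = A ** B + A ** B'"
    "(A - A') ** B = A ** B - A' ** B" "A ** (B - B') = A ** B - A ** B'"
    "(r *\<^sub>R A) ** B = r *\<^sub>R (A ** B)" "A ** (r *\<^sub>R B) = r *\<^sub>R (A ** B)"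
  by (simp_all add: vec_eq_iff matrix_matrix_mult_def sum.distrib sum_subtractf scaleR_sum_right
      algebra_simps)

lemma bounded_linear_matrix_conj:
  "bounded_linear (\<lambda>M :: complex^'n^'n. g ** M ** g')"
proof -
  have "linear (\<lambda>M :: complex^'n^'n. g ** M ** g')"
    by (rule linearI) (simp_all add: matrix_mult_linear)
  then show ?thesis by (simp add: linear_conv_bounded_linear)
qed

text \<open>The product is bounded bilinear, so the Euclidean norm of matrices is submultiplicative up to a
  constant \<open>K\<close> and the series is dominated by an exponential series.\<close>
lemma summable_matrix_exp:
  fixes A :: "complex^'n^'n"
  shows "summable (\<lambda>k. (1 / fact k) *\<^sub>R (((**) A ^^ k) (mat 1)))"
proof -
  have "bilinear ((**) :: complex^'n^'n \<Rightarrow> complex^'n^'n \<Rightarrow> complex^'n^'n)"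
    unfolding bilinear_def
    by (auto intro!: linearI simp: matrix_mult_linear)
  from bilinear_bounded[OF this] obtain K
    where K: "\<And>(B :: complex^'n^'n) (D :: complex^'n^'n). norm (B ** D) \<le> K * norm B * norm D"
    by blast
  let ?c = "K * norm A"
  have c: "norm (A ** D) \<le> ?c * norm D" for D :: "complex^'n^'n"
    using K[of A D] by simp
  have "norm (((**) A ^^ k) (mat 1)) \<le> \<bar>?c\<bar> ^ k * norm (mat 1 :: complex^'n^'n)" for k
  proof (induction k)
    case (Suc k)
    have "norm (((**) A ^^ Suc k) (mat 1)) \<le> \<bar>?c\<bar> * norm (((**) A ^^ k) (mat 1))"
      using c[of "((**) A ^^ k) (mat 1)"] by (simp add: order_trans[OF _ mult_right_mono[OF abs_ge_self]])
    also have "\<dots> \<le> \<bar>?c\<bar> * (\<bar>?c\<bar> ^ k * norm (mat 1 :: complex^'n^'n))"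
      by (rule mult_left_mono[OF Suc]) simp
    finally show ?case by (simp add: mult.assoc)
  qed simp
  then have bound: "norm ((1 / fact k) *\<^sub>R (((**) A ^^ k) (mat 1)))
      \<le> inverse (fact k) * \<bar>?c\<bar> ^ k * norm (mat 1 :: complex^'n^'n)" for k
    by (simp add: divide_inverse mult.assoc)
  have "summable (\<lambda>k. inverse (fact k) * \<bar>?c\<bar> ^ k * norm (mat 1 :: complex^'n^'n))"
    by (intro summable_mult2 summable_exp)
  then show ?thesis
    by (rule summable_comparison_test[rotated]) (use bound in blast)
qed

lemma matrix_exp_conj:
  fixes g A :: "complex^'n^'n"
  assumes g: "invertible g"
  shows "matrix_exp (g ** A ** matrix_inv g) = g ** matrix_exp A ** matrix_inv g"
proof -
  let ?f = "\<lambda>M. g ** M ** matrix_inv g"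
  interpret f: bounded_linear ?f by (rule bounded_linear_matrix_conj)
  have "((**) (?f A) ^^ k) (mat 1) = ?f (((**) A ^^ k) (mat 1))" for k
  proof (induction k)
    case (Suc k)
    have "?f A ** ?f M = ?f (A ** M)" for M
    proof -
      have "?f A ** ?f M = g ** A ** (matrix_inv g ** g) ** M ** matrix_inv g"
        by (simp only: matrix_mul_assoc)
      then show ?thesis by (simp add: matrix_inv_inverse[OF g] matrix_mul_assoc)
    qed
    then show ?case using Suc by simp
  qed (simp add: matrix_inv_inverse[OF g])
  then show ?thesis
    unfolding matrix_exp_def by (simp add: f.suminf[OF summable_matrix_exp] f.scaleR)
qed

lemma matrix_inv_mat_one: "matrix_inv (mat 1 :: complex^'n^'n) = mat 1"
  by (rule matrix_inv_eqI) simp_all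

lemma invertible_mat_one: "invertible (mat 1 :: complex^'n^'n)"
  unfolding invertible_def by (intro exI[of _ "mat 1"]) simp

lemma group_GL: "group (GL :: (complex^'n^'n) monoid)"
proof (rule groupI)
  fix A :: "complex^'n^'n" assume "A \<in> carrier GL"
  then show "\<exists>B\<in>carrier GL. B \<otimes>\<^bsub>GL\<^esub> A = \<one>\<^bsub>GL\<^esub>"
    by (intro bexI[of _ "matrix_inv A"]) (simp_all add: GL_def matrix_inv_inverse invertible_matrix_inv)
qed (auto simp: GL_def invertible_mult matrix_mul_assoc invertible_mat_one)

lemma
  assumes G: "subgroup G (GL :: (complex^'n^'n) monoid)"
  shows subgroup_GL_invertible: "g \<in> G \<Longrightarrow> invertible g"
    and subgroup_GL_mult: "g \<in> G \<Longrightarrow> g' \<in> G \<Longrightarrow> g ** g' \<in> G"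
    and subgroup_GL_inv: "g \<in> G \<Longrightarrow> matrix_inv g \<in> G"
proof -
  show inv: "invertible g" if "g \<in> G" for g using subgroup.mem_carrier[OF G that] by (simp add: GL_def)
  show "g ** g' \<in> G" if "g \<in> G" "g' \<in> G" for g g'
    using subgroup.m_closed[OF G that] by (simp add: GL_def)
  show "matrix_inv g \<in> G" if "g \<in> G" for g
  proof -
    have "inv\<^bsub>GL\<^esub> g = matrix_inv g"
      by (rule group.inv_equality[OF group_GL])
        (use inv[OF that] in \<open>simp_all add: GL_def matrix_inv_inverse invertible_matrix_inv\<close>)
    then show ?thesis using subgroup.m_inv_closed[OF G that] by simp
  qed
qed

text \<open>Conjugation by \<open>g\<close> commutes with the exponential series, so it carries one-parameter subgroups of
  \<open>G\<close> to one-parameter subgroups of \<open>G\<close>.\<close>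
lemma lie_algebra_of_conj:
  assumes G: "subgroup G GL" and g: "g \<in> G" and A: "A \<in> lie_algebra_of G"
  shows "g ** A ** matrix_inv g \<in> lie_algebra_of G"
proof -
  have "matrix_exp (t *\<^sub>R (g ** A ** matrix_inv g)) \<in> G" for t :: real
  proof -
    have "t *\<^sub>R (g ** A ** matrix_inv g) = g ** (t *\<^sub>R A) ** matrix_inv g"
      using bounded_linear.linear[OF bounded_linear_matrix_conj] by (rule linear_scale[symmetric])
    then have "matrix_exp (t *\<^sub>R (g ** A ** matrix_inv g)) = g ** matrix_exp (t *\<^sub>R A) ** matrix_inv g"
      by (simp add: matrix_exp_conj[OF subgroup_GL_invertible[OF G g]])
    moreover have "matrix_exp (t *\<^sub>R A) \<in> G" using A by (simp add: lie_algebra_of_def)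
    ultimately show ?thesis
      using subgroup_GL_mult[OF G] subgroup_GL_inv[OF G] g by simp
  qed
  then show ?thesis by (simp add: lie_algebra_of_def)
qed

lemma matrix_vector_mult_axis:
  fixes M :: "complex^'n^'m"
  shows "(M *v axis i 1) $ k = M $ k $ i"
  by (simp add: matrix_vector_mult_def axis_def if_distrib cong: if_cong)

lemma tensor_action_eq_conj: "tensor_action g T = g ** T ** matrix_inv g"
proof -
  have "tensor_action g T $ k $ l = (g ** T ** matrix_inv g) $ k $ l" for k l
  proof -
    have "tensor_action g T $ k $ l = (\<Sum>i\<in>UNIV. \<Sum>j\<in>UNIV. T $ i $ j * g $ k $ i * matrix_inv g $ j $ l)"
      by (simp add: tensor_action_def tensor_def dual_action_def matrix_vector_mult_axis)
    also have "\<dots> = (\<Sum>j\<in>UNIV. \<Sum>i\<in>UNIV. T $ i $ j * g $ k $ i * matrix_inv g $ j $ l)"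
      by (rule sum.swap)
    also have "\<dots> = (g ** T ** matrix_inv g) $ k $ l"
      by (simp add: matrix_matrix_mult_def sum_distrib_left mult_ac)
    finally show ?thesis .
  qed
  then show ?thesis by (simp add: vec_eq_iff)
qed

lemma tensor_mult_vector:
  assumes "linear_form \<phi>"
  shows "tensor w \<phi> *v u = \<phi> u *s w"
  by (simp add: vec_eq_iff tensor_def matrix_vector_mult_def linear_form_coordinates[OF assms, of u]
      sum_distrib_left mult_ac)

lemma conj_eq_iff_commute:
  assumes "invertible (g :: complex^'n^'n)"
  shows "g ** A ** matrix_inv g = B \<longleftrightarrow> g ** A = B ** g"
proof
  assume "g ** A ** matrix_inv g = B"
  then have "B ** g = g ** A ** (matrix_inv g ** g)" by (simp add: matrix_mul_assoc)
  then show "g ** A = B ** g" by (simp add: matrix_inv_inverse[OF assms])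
next
  assume "g ** A = B ** g"
  then have "g ** A ** matrix_inv g = B ** (g ** matrix_inv g)" by (simp add: matrix_mul_assoc)
  then show "g ** A ** matrix_inv g = B" by (simp add: matrix_inv_inverse[OF assms])
qed

text \<open>The fibres of \<open>g \<mapsto> f g x\<close> are the left cosets of the stabilizer of \<open>x\<close>.\<close>
lemma orbit_bij_lcosets:
  assumes "group \<Gamma>" and f1: "f \<one>\<^bsub>\<Gamma>\<^esub> x = x"
    and fm: "\<And>g k. g \<in> carrier \<Gamma> \<Longrightarrow> k \<in> carrier \<Gamma> \<Longrightarrow> f (g \<otimes>\<^bsub>\<Gamma>\<^esub> k) x = f g (f k x)"
  shows "\<exists>\<phi>. bij_betw \<phi> (lcosets\<^bsub>\<Gamma>\<^esub> (stabilizer \<Gamma> f x)) (orbit \<Gamma> f x)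
    \<and> (\<forall>g\<in>carrier \<Gamma>. \<phi> (g <#\<^bsub>\<Gamma>\<^esub> stabilizer \<Gamma> f x) = f g x)"
proof -
  interpret group \<Gamma> by fact
  let ?Z = "stabilizer \<Gamma> f x"
  define \<phi> where "\<phi> A = f (SOME g. g \<in> A) x" for A
  have \<phi>: "\<phi> (g <#\<^bsub>\<Gamma>\<^esub> ?Z) = f g x" if g: "g \<in> carrier \<Gamma>" for g
  proof -
    have "g \<in> g <#\<^bsub>\<Gamma>\<^esub> ?Z"
      using g f1 by (force simp: l_coset_def stabilizer_def)
    then have "(SOME k. k \<in> g <#\<^bsub>\<Gamma>\<^esub> ?Z) \<in> g <#\<^bsub>\<Gamma>\<^esub> ?Z" by (rule someI)
    then obtain z where "(SOME k. k \<in> g <#\<^bsub>\<Gamma>\<^esub> ?Z) = g \<otimes>\<^bsub>\<Gamma>\<^esub> z" "z \<in> ?Z"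
      by (auto simp: l_coset_def)
    then show ?thesis using g by (simp add: \<phi>_def stabilizer_def fm)
  qed
  have sub: "g <#\<^bsub>\<Gamma>\<^esub> ?Z \<subseteq> k <#\<^bsub>\<Gamma>\<^esub> ?Z"
    if gk: "g \<in> carrier \<Gamma>" "k \<in> carrier \<Gamma>" "f g x = f k x" for g k
  proof
    fix a assume "a \<in> g <#\<^bsub>\<Gamma>\<^esub> ?Z"
    then obtain z where z: "z \<in> carrier \<Gamma>" "f z x = x" "a = g \<otimes>\<^bsub>\<Gamma>\<^esub> z"
      by (auto simp: l_coset_def stabilizer_def)
    have "f (inv\<^bsub>\<Gamma>\<^esub> k \<otimes>\<^bsub>\<Gamma>\<^esub> a) x = f (inv\<^bsub>\<Gamma>\<^esub> k) (f k x)"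
      using z gk by (simp add: fm)
    also have "\<dots> = x" using gk f1 fm[of "inv\<^bsub>\<Gamma>\<^esub> k" k] by simp
    finally have "inv\<^bsub>\<Gamma>\<^esub> k \<otimes>\<^bsub>\<Gamma>\<^esub> a \<in> ?Z" using z gk by (simp add: stabilizer_def)
    moreover have "a = k \<otimes>\<^bsub>\<Gamma>\<^esub> (inv\<^bsub>\<Gamma>\<^esub> k \<otimes>\<^bsub>\<Gamma>\<^esub> a)"
      using z gk by (simp add: m_assoc[symmetric])
    ultimately show "a \<in> k <#\<^bsub>\<Gamma>\<^esub> ?Z" unfolding l_coset_def by blast
  qed
  have "bij_betw \<phi> (lcosets\<^bsub>\<Gamma>\<^esub> ?Z) (orbit \<Gamma> f x)"
    unfolding bij_betw_def
  proof
    show "inj_on \<phi> (lcosets\<^bsub>\<Gamma>\<^esub> ?Z)"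
    proof (rule inj_onI)
      fix A B assume "A \<in> lcosets\<^bsub>\<Gamma>\<^esub> ?Z" "B \<in> lcosets\<^bsub>\<Gamma>\<^esub> ?Z" "\<phi> A = \<phi> B"
      then obtain g k where "g \<in> carrier \<Gamma>" "k \<in> carrier \<Gamma>" "A = g <#\<^bsub>\<Gamma>\<^esub> ?Z" "B = k <#\<^bsub>\<Gamma>\<^esub> ?Z"
        by (auto simp: LCOSETS_def)
      with \<open>\<phi> A = \<phi> B\<close> sub[of g k] sub[of k g] show "A = B" by (simp add: \<phi>)
    qed
    have "lcosets\<^bsub>\<Gamma>\<^esub> ?Z = (\<lambda>g. g <#\<^bsub>\<Gamma>\<^esub> ?Z) ` carrier \<Gamma>"
      unfolding LCOSETS_def by blast
    moreover have "orbit \<Gamma> f x = (\<lambda>g. f g x) ` carrier \<Gamma>"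
      unfolding orbit_def by blast
    ultimately show "\<phi> ` (lcosets\<^bsub>\<Gamma>\<^esub> ?Z) = orbit \<Gamma> f x"
      by (simp add: image_image \<phi> cong: image_cong)
  qed
  then show ?thesis using \<phi> by blast
qed


section \<open>The isotropy group\<close>

context highest_weight_rep
begin

lemma Ad_eqI:
  assumes "inj \<rho>" "\<rho> Y = g ** \<rho> X ** matrix_inv g"
  shows "Ad \<rho> g X = Y"
  using assms unfolding Ad_def by (metis the_inv_f_f)

text \<open>\<open>Ad g\<close> is an automorphism of the Lie algebra, hence an isometry of the Killing form.\<close>
lemma killing_form_conjugate:
  assumes inj: "inj \<rho>" and g: "invertible g"
    and range: "\<And>X. g ** \<rho> X ** matrix_inv g \<in> range \<rho>" "\<And>X. matrix_inv g ** \<rho> X ** g \<in> range \<rho>"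
    and X: "\<rho> X' = g ** \<rho> X ** matrix_inv g" and Y: "\<rho> Y' = g ** \<rho> Y ** matrix_inv g"
  shows "killing_form X' Y' = killing_form X Y"
proof -
  define f where "f = Ad \<rho> g"
  have \<rho>f: "\<rho> (f Z) = g ** \<rho> Z ** matrix_inv g" for Z
  proof -
    obtain Z' where "\<rho> Z' = g ** \<rho> Z ** matrix_inv g" using range(1)[of Z] by (metis imageE)
    then show ?thesis using Ad_eqI[OF inj] by (metis f_def)
  qed
  have eqI: "f a = b" if "\<rho> (f a) = \<rho> b" for a b using inj that by (simp add: inj_eq)
  have cancel: "matrix_inv g ** (g ** M) = M" "g ** (matrix_inv g ** M) = M" for M :: "complex^'n^'n"
    by (simp_all add: matrix_mul_assoc matrix_inv_inverse[OF g])
  have "lie_linear f"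
  proof (rule lie_linearI)
    show "f (a + b) = f a + f b" for a b
      by (rule eqI) (simp add: \<rho>f rep matrix_mult_linear)
    show "f (c *\<^sub>C a) = c *\<^sub>C f a" for c a
    proof (rule eqI)
      have "\<rho> (f (c *\<^sub>C a)) *v w = \<rho> (c *\<^sub>C f a) *v w" for w
        by (simp add: \<rho>f rep matrix_vector_mul_assoc[symmetric] vec.scale)
      then show "\<rho> (f (c *\<^sub>C a)) = \<rho> (c *\<^sub>C f a)" by (simp add: matrix_eq)
    qed
  qed
  moreover have "bij f"
  proof (rule bijI)
    show "inj f"
    proof (rule injI)
      fix a b assume "f a = f b"
      then have "g ** \<rho> a = g ** \<rho> b"
        using \<rho>f[of a] \<rho>f[of b] conj_eq_iff_commute[OF g] by metis
      then have "\<rho> a = \<rho> b" by (metis cancel(1))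
      then show "a = b" using inj by (simp add: inj_eq)
    qed
    show "surj f"
    proof (rule surjI)
      fix b
      obtain a where a: "\<rho> a = matrix_inv g ** \<rho> b ** g" using range(2)[of b] by (metis imageE)
      have "f a = b"
        by (rule eqI) (simp add: \<rho>f a conj_eq_iff_commute[OF g] matrix_mul_assoc[symmetric] cancel
            matrix_inv_inverse[OF g])
      then show "f (SOME a. f a = b) = b" by (rule someI)
    qed
  qed
  moreover have "f (lie_bracket a b) = lie_bracket (f a) (f b)" for a b
  proof (rule eqI)
    show "\<rho> (f (lie_bracket a b)) = \<rho> (lie_bracket (f a) (f b))"
      by (simp add: \<rho>f rep matrix_mul_assoc[symmetric] cancel matrix_mult_linear)
  qed
  ultimately have "killing_form (f X) (f Y) = killing_form X Y"
    by (rule killing_form_automorphism)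
  moreover have "f X = X'" "f Y = Y'" unfolding f_def using Ad_eqI[OF inj] X Y by blast+
  ultimately show ?thesis by simp
qed

text \<open>As the tensor is the operator \<open>w \<mapsto> \<epsilon>\<^sub>0(w) v\<^sub>0\<close>, commuting with it means \<open>\<epsilon>\<^sub>0(w) g v\<^sub>0 = \<epsilon>\<^sub>0(g w) v\<^sub>0\<close> for
  all \<open>w\<close>; put \<open>w = v\<^sub>0\<close> for the first condition and apply \<open>\<epsilon>\<^sub>0\<close> for the second.\<close>
lemma commutes_with_tensor_iff:
  "g ** tensor v\<^sub>0 \<epsilon>\<^sub>0 = tensor v\<^sub>0 \<epsilon>\<^sub>0 ** g
    \<longleftrightarrow> (\<exists>a. g *v v\<^sub>0 = a *s v\<^sub>0 \<and> (\<forall>w. \<epsilon>\<^sub>0 (g *v w) = a * \<epsilon>\<^sub>0 w))"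
proof -
  have "g ** tensor v\<^sub>0 \<epsilon>\<^sub>0 = tensor v\<^sub>0 \<epsilon>\<^sub>0 ** g
      \<longleftrightarrow> (\<forall>w. \<epsilon>\<^sub>0 w *s (g *v v\<^sub>0) = \<epsilon>\<^sub>0 (g *v w) *s v\<^sub>0)"
    by (simp add: matrix_eq matrix_vector_mul_assoc[symmetric] tensor_mult_vector[OF lin_\<epsilon>] vec.scale)
  also have "\<dots> \<longleftrightarrow> (\<exists>a. g *v v\<^sub>0 = a *s v\<^sub>0 \<and> (\<forall>w. \<epsilon>\<^sub>0 (g *v w) = a * \<epsilon>\<^sub>0 w))"
  proof
    assume *: "\<forall>w. \<epsilon>\<^sub>0 w *s (g *v v\<^sub>0) = \<epsilon>\<^sub>0 (g *v w) *s v\<^sub>0"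
    then have gv: "g *v v\<^sub>0 = \<epsilon>\<^sub>0 (g *v v\<^sub>0) *s v\<^sub>0" using \<epsilon>_v by (metis vec.scale_one)
    have "\<epsilon>\<^sub>0 (g *v w) = \<epsilon>\<^sub>0 (g *v v\<^sub>0) * \<epsilon>\<^sub>0 w" for w
    proof -
      have "\<epsilon>\<^sub>0 (\<epsilon>\<^sub>0 w *s (g *v v\<^sub>0)) = \<epsilon>\<^sub>0 (\<epsilon>\<^sub>0 (g *v w) *s v\<^sub>0)" using * by simp
      then show ?thesis by (simp add: \<epsilon>_linear \<epsilon>_v mult.commute)
    qed
    then show "\<exists>a. g *v v\<^sub>0 = a *s v\<^sub>0 \<and> (\<forall>w. \<epsilon>\<^sub>0 (g *v w) = a * \<epsilon>\<^sub>0 w)" using gv by blast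
  qed (auto simp: mult.commute)
  finally show ?thesis .
qed

text \<open>Let \<open>Y = Ad g H\<mu>\<close>.  If \<open>g\<close> fixes the tensor, with eigenvalue \<open>a\<close> on \<open>v\<^sub>0\<close>, then for every \<open>X\<close> and
  \<open>X' = Ad g\<^sup>-\<^sup>1 X\<close> invariance of the Killing form gives
  \<open>a K Y X = a K H\<mu> X' = \<epsilon>\<^sub>0 (g \<rho>(X') v\<^sub>0) = \<epsilon>\<^sub>0 (\<rho>(X) g v\<^sub>0) = a K H\<mu> X\<close>, so \<open>Y = H\<mu>\<close> by nondegeneracy.  Conversely,
  an element commuting with \<open>\<rho> H\<mu>\<close> respects its eigenspaces and hence the tensor.\<close>
lemma stabilizer_eq_centralizer:
  assumes inj: "inj \<rho>" and G: "subgroup G GL" and L: "lie_algebra_of G = range \<rho>"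
  shows "stabilizer (group_of G) tensor_action (tensor v\<^sub>0 \<epsilon>\<^sub>0) = centralizer \<rho> G H\<mu>"
proof -
  have conj: "g ** \<rho> X ** matrix_inv g \<in> range \<rho>" if "g \<in> G" for g X
    using lie_algebra_of_conj[OF G that] L by blast
  have inv_inv: "matrix_inv (matrix_inv g) = g" if "g \<in> G" for g
    using subgroup_GL_invertible[OF G that] by (rule matrix_inv_involutive)
  have conj': "matrix_inv g ** \<rho> X ** g \<in> range \<rho>" if "g \<in> G" for g X
    using conj[OF subgroup_GL_inv[OF G that]] inv_inv[OF that] by simp
  have "tensor_action g (tensor v\<^sub>0 \<epsilon>\<^sub>0) = tensor v\<^sub>0 \<epsilon>\<^sub>0 \<longleftrightarrow> Ad \<rho> g H\<mu> = H\<mu>" if gG: "g \<in> G" for g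
  proof -
    note g = subgroup_GL_invertible[OF G gG]
    obtain Y where Y: "\<rho> Y = g ** \<rho> H\<mu> ** matrix_inv g" using conj[OF gG, of H\<mu>] by (metis imageE)
    have Ad: "Ad \<rho> g H\<mu> = Y" using Y by (rule Ad_eqI[OF inj])
    have "g ** tensor v\<^sub>0 \<epsilon>\<^sub>0 = tensor v\<^sub>0 \<epsilon>\<^sub>0 ** g \<longleftrightarrow> Y = H\<mu>"
    proof
      assume "g ** tensor v\<^sub>0 \<epsilon>\<^sub>0 = tensor v\<^sub>0 \<epsilon>\<^sub>0 ** g"
      then obtain a where a: "g *v v\<^sub>0 = a *s v\<^sub>0" "\<And>w. \<epsilon>\<^sub>0 (g *v w) = a * \<epsilon>\<^sub>0 w"
        by (auto simp: commutes_with_tensor_iff)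
      have "a \<noteq> 0"
      proof
        assume "a = 0"
        then have "matrix_inv g *v (g *v v\<^sub>0) = 0" using a(1) by simp
        then show False using v_nonzero by (simp add: matrix_vector_mul_assoc matrix_inv_inverse[OF g])
      qed
      show "Y = H\<mu>"
      proof (rule killing_form_eqI)
        fix X
        obtain X' where X': "\<rho> X' = matrix_inv g ** \<rho> X ** g" using conj'[OF gG, of X] by (metis imageE)
        have gX': "g ** \<rho> X' = \<rho> X ** g"
          by (simp add: X' matrix_mul_assoc matrix_inv_inverse[OF g])
        then have "\<rho> X = g ** \<rho> X' ** matrix_inv g"
          using conj_eq_iff_commute[OF g] by metis
        then have "killing_form Y X = killing_form H\<mu> X'"
          by (rule killing_form_conjugate[OF inj g conj[OF gG] conj'[OF gG] Y])
        also have "a * \<dots> = \<epsilon>\<^sub>0 (g *v (\<rho> X' *v v\<^sub>0))" by (simp add: killing_form_H\<mu> a)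
        also have "\<dots> = \<epsilon>\<^sub>0 (\<rho> X *v (g *v v\<^sub>0))" by (simp add: matrix_vector_mul_assoc gX')
        also have "\<dots> = a * killing_form H\<mu> X" by (simp add: killing_form_H\<mu> a vec.scale \<epsilon>_linear)
        finally show "killing_form Y X = killing_form H\<mu> X" using \<open>a \<noteq> 0\<close> by simp
      qed
    next
      assume "Y = H\<mu>"
      then have "g ** \<rho> H\<mu> = \<rho> H\<mu> ** g" using Y conj_eq_iff_commute[OF g] by metis
      then show "g ** tensor v\<^sub>0 \<epsilon>\<^sub>0 = tensor v\<^sub>0 \<epsilon>\<^sub>0 ** g"
        unfolding commutes_with_tensor_iff by (rule commuting_operator_eigenvector) blast
    qed
    then show ?thesis unfolding Ad tensor_action_eq_conj conj_eq_iff_commute[OF g] .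
  qed
  then show ?thesis by (auto simp: stabilizer_def centralizer_def)
qed

end

theorem proposition4p3:
  fixes h C :: "'g::complex_lie_algebra set"
    and \<Theta>\<^sub>0 :: "('g \<Rightarrow> complex) set"
    and \<omega> :: "('g \<Rightarrow> complex) \<Rightarrow> ('g \<Rightarrow> complex)"
    and \<mu> :: "'g \<Rightarrow> complex"
    and H\<^sub>\<mu> :: 'g
    and \<rho> :: "'g \<Rightarrow> complex^'n^'n"
    and G :: "(complex^'n^'n) set"
    and N :: nat
    and v :: "nat \<Rightarrow> complex^'n"
    and \<epsilon> :: "nat \<Rightarrow> complex^'n \<Rightarrow> complex"
  assumes "semisimple TYPE('g)"
    and "cartan_subalgebra h"
    and "weyl_chamber h C"
    and "fundamental_weights h C \<omega>"
    and "\<Theta>\<^sub>0 \<subseteq> simple_roots h C"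
    and "\<mu> = (\<lambda>H. \<Sum>\<alpha>\<in>simple_roots h C - \<Theta>\<^sub>0. \<omega> \<alpha> H)"
    and "H\<^sub>\<mu> = dual_vector h \<mu>"
    and "irreducible_rep \<rho>"
    and "has_highest_weight h C \<rho> \<mu>"
    and "inj \<rho>"
    and "connected_linear_group G (range \<rho>)"
    and "weight_basis h \<rho> N v"
    and "highest_weight_vector h C \<rho> \<mu> (v 0)"
    and "dual_basis N v \<epsilon>"
  shows "stabilizer (group_of G) tensor_action (tensor (v 0) (\<epsilon> 0)) = centralizer \<rho> G H\<^sub>\<mu>
    \<and> (\<exists>\<phi>. bij_betw \<phi> (lcosets\<^bsub>group_of G\<^esub> (centralizer \<rho> G H\<^sub>\<mu>))
                     (orbit (group_of G) tensor_action (tensor (v 0) (\<epsilon> 0)))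
           \<and> (\<forall>g\<in>G. \<phi> (g <#\<^bsub>group_of G\<^esub> centralizer \<rho> G H\<^sub>\<mu>)
                     = tensor_action g (tensor (v 0) (\<epsilon> 0))))"
proof -
  have G: "subgroup G GL" and L: "lie_algebra_of G = range \<rho>"
    using assms(11) by (auto simp: connected_linear_group_def)
  have \<epsilon>0: "linear_form (\<epsilon> 0)" and \<epsilon>v: "\<And>j. j \<le> N \<Longrightarrow> \<epsilon> 0 (v j) = (if j = 0 then 1 else 0)"
    using assms(14) unfolding dual_basis_def by auto
  interpret e: module_hom "(*s)" "(*)" "\<epsilon> 0"
    using \<epsilon>0 by (rule Vector_Spaces.linear.axioms(3))
  have weight: "\<epsilon> 0 (\<rho> H *v w) = \<mu> H * \<epsilon> 0 w" if H: "H \<in> h" for H w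
  proof -
    have "w \<in> vec.span (v ` {0..N})" using assms(12) by (simp add: weight_basis_def)
    then show ?thesis
    proof (rule vec.span_induct)
      show "vec.subspace {w. \<epsilon> 0 (\<rho> H *v w) = \<mu> H * \<epsilon> 0 w}"
        by (auto simp: vec.subspace_def vec.add vec.scale vec.zero e.add e.scale e.zero algebra_simps)
      fix x assume "x \<in> v ` {0..N}"
      then obtain i where i: "i \<le> N" "x = v i" by auto
      obtain \<xi> where "v i \<in> weight_space h \<rho> \<xi>"
        using assms(12) i(1) by (auto simp: weight_basis_def)
      then have \<xi>: "\<rho> H *v v i = \<xi> H *s v i" using H by (simp add: weight_space_def)
      have "\<rho> H *v v 0 = \<mu> H *s v 0"
        using assms(13) H by (simp add: highest_weight_vector_def weight_space_def)
      then show "\<epsilon> 0 (\<rho> H *v x) = \<mu> H * \<epsilon> 0 x"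
        using \<xi> i \<epsilon>v[OF i(1)] by (cases "i = 0") (simp_all add: e.scale)
    qed
  qed
  interpret highest_weight_rep h C \<rho> \<mu> "v 0" "\<epsilon> 0"
    by unfold_locales (use assms(1,2,3,8,13) \<epsilon>0 \<epsilon>v[of 0] weight in auto)
  have stab: "stabilizer (group_of G) tensor_action (tensor (v 0) (\<epsilon> 0)) = centralizer \<rho> G H\<^sub>\<mu>"
    unfolding assms(7) by (rule stabilizer_eq_centralizer[OF assms(10) G L])
  have "group (group_of G)" by (rule subgroup.subgroup_is_group[OF G group_GL])
  then have "\<exists>\<phi>. bij_betw \<phi>
        (lcosets\<^bsub>group_of G\<^esub> (stabilizer (group_of G) tensor_action (tensor (v 0) (\<epsilon> 0))))
        (orbit (group_of G) tensor_action (tensor (v 0) (\<epsilon> 0)))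
    \<and> (\<forall>g\<in>carrier (group_of G). \<phi> (g <#\<^bsub>group_of G\<^esub>
          stabilizer (group_of G) tensor_action (tensor (v 0) (\<epsilon> 0)))
        = tensor_action g (tensor (v 0) (\<epsilon> 0)))"
  proof (rule orbit_bij_lcosets)
    show "tensor_action \<one>\<^bsub>group_of G\<^esub> (tensor (v 0) (\<epsilon> 0)) = tensor (v 0) (\<epsilon> 0)"
      by (simp add: tensor_action_eq_conj GL_def matrix_inv_mat_one)
    fix g k assume "g \<in> carrier (group_of G)" "k \<in> carrier (group_of G)"
    then have "matrix_inv (g ** k) = matrix_inv k ** matrix_inv g"
      using subgroup_GL_invertible[OF G] by (intro matrix_inv_mult) auto
    then show "tensor_action (g \<otimes>\<^bsub>group_of G\<^esub> k) (tensor (v 0) (\<epsilon> 0))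
        = tensor_action g (tensor_action k (tensor (v 0) (\<epsilon> 0)))"
      by (simp add: tensor_action_eq_conj GL_def matrix_mul_assoc)
  qed
  then show ?thesis unfolding stab by simp
qed

end
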